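(* Let $\mathcal E$ be a regular Dirichlet form on $L^2(X,m)$ and let $\varrho$ be an intrinsic metric for $\mathcal E$. Then every function $u:X\to\mathbb R$ with $|u(x)-u(y)|\le\varrho(x,y)$ for all $x,y\in X$ satisfies $u\in\mathcal D_{loc}^*$ and $\mu^{(d)}(u)\le m$.
   Context: Setting. $X$ is a locally compact separable metric space, $m$ a positive Radon measure on $X$ with $\operatorname{supp} m=X$; all functions are real valued; $C(X)$ denotes the continuous functions and $C_c(X)$ the continuous compactly supported functions. $\mathcal E:\mathcal D\times\mathcal D\to\mathbb R$, with $\mathcal D$ dense in $L^2(X,m)$, is a regular (symmetric) Dirichlet form: it is closed, non-negative, $\mathcal E(T\circ u,T\circ u)\le\mathcal E(u,u)$ for all normal contractions $T$, and $\mathcal D\cap C_c(X)$ is dense in $\mathcal D$ with respect to $\sqrt{\mathcal E_1}$, where $\mathcal E_1(u,u)=\mathcal E(u,u)+\|u\|_{L^2}^2$, and dense in $C_c(X)$ with respect to $\|\cdot\|_\infty$. For bilinear expressions $q$ write $q(u):=q(u,u)$. Capacity: $\operatorname{cap}(U)=\inf\{\mathcal E_1(v): v\in\mathcal D,\ 1_U\le v\}$ for $U$ open, $\operatorname{cap}(A)=\inf\{\operatorname{cap}(U):A\subset U,\ U\text{ open}\}$ in general. "q.e." means outside a set of capacity zero. $\tilde u$ denotes a quasi-continuous representative of $u$; it exists for every $u\in\mathcal D$ and every $u\in\mathcal D_{loc}$ (below) and is unique q.e. Beurling–Deny formula: with $d=\{(x,x):x\in X\}$, there are a non-negative Radon measure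 $k$ on $X$, a non-negative symmetric Radon measure $J$ on $X\times X\setminus d$, and a positive semidefinite bilinear form $\mu^{(c)}$ on $\mathcal D$ with values in the signed Radon measures on $X$, strongly local (i.e. $\mu^{(c)}(u,v)=0$ if $u$ is constant on $\operatorname{supp}v$), such that for $u\in\mathcal D$ $$\mathcal E(u)=\int_{X\times X\setminus d}(\tilde u(x)-\tilde u(y))^2\,J(dx,dy)+\int_X d\mu^{(c)}(u)+\int_X\tilde u^2\,dk.$$ Local spaces: $\mathcal D_{loc}$ is the set of $u\in L^2_{loc}$ such that for every open relatively compact $G\subset X$ there is $v\in\mathcal D$ with $u=v$ on $G$. $\mathcal D_{loc}^*$ is the set of $u\in\mathcal D_{loc}$ with $\int_{K\times X\setminus d}(\tilde u(x)-\tilde u(y))^2J(dx,dy)<\infty$ for all compact $K\subset X$. $\mu^{(c)}$ is extended to $\mathcal D_{loc}$ by locality ($\mu^{(c)}(u)=\mu^{(c)}(v)$ on $G$ if $u=v$ on the open relatively compact set $G$). For $u\in\mathcal D_{loc}^*$ put $\mu^{(b)}(u)(E)=\int_{E\times X\setminus d}(\tilde u(x)-\tilde u(y))^2J(dx,dy)$ for measurable $E\subset X$, and $\mu^{(d)}=\mu^{(b)}+\mu^{(c)}$. A pseudo-metric is a map $\varrho:X\times X\to[0,\infty]$ with $\varrho(x,x)=0$, symmetric, satisfying the triangle inequality; $\varrho_A(x):=\inf_{y\in A}\varrho(x,y)$ for $A\subset X$. A pseudo-metric $\varrho$ is an intrinsic metric for $\mathcal E$ if there are Radon measures $m_b,m_c$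 with $m_b+m_c\le m$ such that for all $A\subset X$ and all $T>0$: $\varrho_A\wedge T\in\mathcal D_{loc}^*\cap C(X)$, $\mu^{(b)}(\varrho_A\wedge T)\le m_b$ and $\mu^{(c)}(\varrho_A\wedge T)\le m_c$. (Continuity is with respect to the original topology of $X$.) *)

theory Defs
  imports "HOL-Analysis.Analysis"
begin

text \<open>Functions are representatives: an element of \<open>L\<^sup>2(X,m)\<close>, or of a space of \<open>m\<close>-classes,
  is a Borel function, and such spaces are closed under \<open>m\<close>-a.e. equality. The space \<open>X\<close> is
  the universe of a second countable (equivalently, separable) metric type; its local compactness
  is an explicit assumption.\<close>

text \<open>On a locally compact second countable Hausdorff space \<open>S\<close>, every Borel measure that is finite
  on compact sets is regular, so local finiteness is all that is required of a Radon measure.\<close>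

definition radon_on :: "'a::topological_space set \<Rightarrow> 'a measure \<Rightarrow> bool" where
  "radon_on S M \<longleftrightarrow> sets M = sets (restrict_space borel S) \<and>
     (\<forall>C. compact C \<and> C \<subseteq> S \<longrightarrow> emeasure M C < \<infinity>)"

abbreviation radon_measure :: "'a::topological_space measure \<Rightarrow> bool" where
  "radon_measure \<equiv> radon_on UNIV"

definition measure_support :: "'a::topological_space measure \<Rightarrow> 'a set" where
  "measure_support M = {x. \<forall>U. open U \<and> x \<in> U \<longrightarrow> emeasure M U > 0}"

definition rel_compact :: "'a::topological_space set \<Rightarrow> bool" where
  "rel_compact B \<longleftrightarrow> compact (closure B)"

text \<open>A signed Radon measure need not have a value on every Borel set (its positive and negative
  part may both be infinite). It is represented by its values on relatively compact Borel sets;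
  other values are irrelevant.\<close>

definition signed_radon_measure :: "('a::topological_space set \<Rightarrow> real) \<Rightarrow> bool" where
  "signed_radon_measure \<nu> \<longleftrightarrow>
     (\<forall>K A. compact K \<and> range A \<subseteq> sets borel \<and> disjoint_family A \<and> (\<Union>i::nat. A i) \<subseteq> K \<longrightarrow>
        (\<lambda>i. \<nu> (A i)) sums \<nu> (\<Union>i. A i))"

definition L2 :: "'a measure \<Rightarrow> ('a \<Rightarrow> real) set" where
  "L2 m = {u \<in> borel_measurable m. integrable m (\<lambda>x. (u x)\<^sup>2)}"

definition L2_loc :: "'a::topological_space measure \<Rightarrow> ('a \<Rightarrow> real) set" where
  "L2_loc m = {u \<in> borel_measurable m. \<forall>K. compact K \<longrightarrow> set_integrable m K (\<lambda>x. (u x)\<^sup>2)}"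

definition L2_norm :: "'a measure \<Rightarrow> ('a \<Rightarrow> real) \<Rightarrow> real" where
  "L2_norm m u = sqrt (\<integral>x. (u x)\<^sup>2 \<partial>m)"

definition Cc :: "('a::topological_space \<Rightarrow> real) set" where
  "Cc = {f. continuous_on UNIV f \<and> compact (closure {x. f x \<noteq> 0})}"

text \<open>The support of the class of \<open>v\<close>, i.e. of the measure \<open>\<bar>v\<bar> m\<close>.\<close>

definition ae_support :: "'a::topological_space measure \<Rightarrow> ('a \<Rightarrow> real) \<Rightarrow> 'a set" where
  "ae_support m v = {x. \<forall>U. open U \<and> x \<in> U \<longrightarrow> \<not> (AE y in m. y \<in> U \<longrightarrow> v y = 0)}"

definition normal_contraction :: "(real \<Rightarrow> real) \<Rightarrow> bool" where
  "normal_contraction T \<longleftrightarrow> T 0 = 0 \<and> (\<forall>s t. \<bar>T s - T t\<bar> \<le> \<bar>s - t\<bar>)"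

definition E1 :: "'a measure \<Rightarrow> (('a \<Rightarrow> real) \<Rightarrow> ('a \<Rightarrow> real) \<Rightarrow> real) \<Rightarrow> ('a \<Rightarrow> real) \<Rightarrow> real" where
  "E1 m \<E> u = \<E> u u + (L2_norm m u)\<^sup>2"

locale regular_dirichlet_form =
  fixes m :: "'a::{metric_space,second_countable_topology} measure"
    and \<D> :: "('a \<Rightarrow> real) set"
    and \<E> :: "('a \<Rightarrow> real) \<Rightarrow> ('a \<Rightarrow> real) \<Rightarrow> real"
  assumes subset_L2: "\<D> \<subseteq> L2 m"
    and zero_mem: "(\<lambda>x. 0) \<in> \<D>"
    and add_mem: "\<And>u v. u \<in> \<D> \<Longrightarrow> v \<in> \<D> \<Longrightarrow> (\<lambda>x. u x + v x) \<in> \<D>"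
    and scale_mem: "\<And>c u. u \<in> \<D> \<Longrightarrow> (\<lambda>x. c * u x) \<in> \<D>"
    and class_mem: "\<And>u v. u \<in> \<D> \<Longrightarrow> v \<in> borel_measurable m \<Longrightarrow> AE x in m. u x = v x \<Longrightarrow> v \<in> \<D>"
    and class_form: "\<And>u v w. u \<in> \<D> \<Longrightarrow> v \<in> \<D> \<Longrightarrow> w \<in> \<D> \<Longrightarrow> AE x in m. u x = v x \<Longrightarrow> \<E> u w = \<E> v w"
    and dense: "\<And>f \<epsilon>. f \<in> L2 m \<Longrightarrow> \<epsilon> > 0 \<Longrightarrow> \<exists>u\<in>\<D>. L2_norm m (\<lambda>x. f x - u x) < \<epsilon>"
    and form_add: "\<And>u v w. u \<in> \<D> \<Longrightarrow> v \<in> \<D> \<Longrightarrow> w \<in> \<D> \<Longrightarrow> \<E> (\<lambda>x. u x + v x) w = \<E> u w + \<E> v w"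
    and form_scale: "\<And>c u w. u \<in> \<D> \<Longrightarrow> w \<in> \<D> \<Longrightarrow> \<E> (\<lambda>x. c * u x) w = c * \<E> u w"
    and form_sym: "\<And>u v. u \<in> \<D> \<Longrightarrow> v \<in> \<D> \<Longrightarrow> \<E> u v = \<E> v u"
    and form_nonneg: "\<And>u. u \<in> \<D> \<Longrightarrow> \<E> u u \<ge> 0"
    and closed_form: "\<And>w :: nat \<Rightarrow> 'a \<Rightarrow> real. (\<And>n. w n \<in> \<D>) \<Longrightarrow>
       (\<forall>\<epsilon>>0. \<exists>N. \<forall>i\<ge>N. \<forall>j\<ge>N. sqrt (E1 m \<E> (\<lambda>x. w i x - w j x)) < \<epsilon>) \<Longrightarrow>
       \<exists>u\<in>\<D>. (\<lambda>n. sqrt (E1 m \<E> (\<lambda>x. w n x - u x))) \<longlonglongrightarrow> 0"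
    and contraction: "\<And>T u. normal_contraction T \<Longrightarrow> u \<in> \<D> \<Longrightarrow>
       T \<circ> u \<in> \<D> \<and> \<E> (T \<circ> u) (T \<circ> u) \<le> \<E> u u"
    and dense_form: "\<And>u \<epsilon>. u \<in> \<D> \<Longrightarrow> \<epsilon> > 0 \<Longrightarrow>
       \<exists>v\<in>\<D> \<inter> Cc. sqrt (E1 m \<E> (\<lambda>x. u x - v x)) < \<epsilon>"
    and dense_Cc: "\<And>f \<epsilon>. f \<in> Cc \<Longrightarrow> \<epsilon> > 0 \<Longrightarrow> \<exists>v\<in>\<D> \<inter> Cc. \<forall>x. \<bar>f x - v x\<bar> < \<epsilon>"

definition cap_open :: "'a measure \<Rightarrow> ('a \<Rightarrow> real) set \<Rightarrow>
    (('a \<Rightarrow> real) \<Rightarrow> ('a \<Rightarrow> real) \<Rightarrow> real) \<Rightarrow> 'a set \<Rightarrow> ennreal" where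
  "cap_open m \<D> \<E> U = (INF v \<in> {v \<in> \<D>. AE x in m. indicator U x \<le> v x}. ennreal (E1 m \<E> v))"

definition quasi_continuous :: "'a::topological_space measure \<Rightarrow> ('a \<Rightarrow> real) set \<Rightarrow>
    (('a \<Rightarrow> real) \<Rightarrow> ('a \<Rightarrow> real) \<Rightarrow> real) \<Rightarrow> ('a \<Rightarrow> real) \<Rightarrow> bool" where
  "quasi_continuous m \<D> \<E> v \<longleftrightarrow>
     (\<forall>\<epsilon>>0. \<exists>U. open U \<and> cap_open m \<D> \<E> U < ennreal \<epsilon> \<and> continuous_on (- U) v)"

text \<open>A quasi-continuous function agrees with a Borel function outside a set of capacity zero;
  representatives are taken to be Borel so that they can be integrated.\<close>

definition qc_version :: "'a::topological_space measure \<Rightarrow> ('a \<Rightarrow> real) set \<Rightarrow>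
    (('a \<Rightarrow> real) \<Rightarrow> ('a \<Rightarrow> real) \<Rightarrow> real) \<Rightarrow> ('a \<Rightarrow> real) \<Rightarrow> ('a \<Rightarrow> real) \<Rightarrow> bool" where
  "qc_version m \<D> \<E> u v \<longleftrightarrow>
     v \<in> borel_measurable borel \<and> quasi_continuous m \<D> \<E> v \<and> (AE x in m. v x = u x)"

definition qc_rep :: "'a::topological_space measure \<Rightarrow> ('a \<Rightarrow> real) set \<Rightarrow>
    (('a \<Rightarrow> real) \<Rightarrow> ('a \<Rightarrow> real) \<Rightarrow> real) \<Rightarrow> ('a \<Rightarrow> real) \<Rightarrow> 'a \<Rightarrow> real" where
  "qc_rep m \<D> \<E> u = (SOME v. qc_version m \<D> \<E> u v)"

definition D_loc :: "'a::topological_space measure \<Rightarrow> ('a \<Rightarrow> real) set \<Rightarrow> ('a \<Rightarrow> real) set" where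
  "D_loc m \<D> = {u \<in> L2_loc m. \<forall>G. open G \<and> rel_compact G \<longrightarrow>
     (\<exists>v\<in>\<D>. AE x in m. x \<in> G \<longrightarrow> u x = v x)}"

definition mu_b :: "'a::topological_space measure \<Rightarrow> ('a \<Rightarrow> real) set \<Rightarrow>
    (('a \<Rightarrow> real) \<Rightarrow> ('a \<Rightarrow> real) \<Rightarrow> real) \<Rightarrow> ('a \<times> 'a) measure \<Rightarrow> ('a \<Rightarrow> real) \<Rightarrow> 'a set \<Rightarrow> ennreal" where
  "mu_b m \<D> \<E> J u B = (\<integral>\<^sup>+p\<in>(B \<times> UNIV - Id).
     ennreal ((qc_rep m \<D> \<E> u (fst p) - qc_rep m \<D> \<E> u (snd p))\<^sup>2) \<partial>J)"

definition D_loc_star :: "'a::topological_space measure \<Rightarrow> ('a \<Rightarrow> real) set \<Rightarrow>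
    (('a \<Rightarrow> real) \<Rightarrow> ('a \<Rightarrow> real) \<Rightarrow> real) \<Rightarrow> ('a \<times> 'a) measure \<Rightarrow> ('a \<Rightarrow> real) set" where
  "D_loc_star m \<D> \<E> J = {u \<in> D_loc m \<D>. \<forall>K. compact K \<longrightarrow> mu_b m \<D> \<E> J u K < \<infinity>}"

text \<open>Extension of \<open>\<mu>\<close> from \<open>\<D>\<close> to \<open>D_loc\<close> by locality: the unique Borel measure that coincides
  with \<open>\<mu>(v,v)\<close> on \<open>G\<close> whenever \<open>u = v\<close> on the relatively compact open set \<open>G\<close>.\<close>

definition mu_c :: "'a::topological_space measure \<Rightarrow> ('a \<Rightarrow> real) set \<Rightarrow>
    (('a \<Rightarrow> real) \<Rightarrow> ('a \<Rightarrow> real) \<Rightarrow> 'a set \<Rightarrow> real) \<Rightarrow> ('a \<Rightarrow> real) \<Rightarrow> 'a measure" where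
  "mu_c m \<D> \<mu> u = (THE M. sets M = sets borel \<and>
     (\<forall>G v. open G \<and> rel_compact G \<and> v \<in> \<D> \<and> (AE x in m. x \<in> G \<longrightarrow> u x = v x) \<longrightarrow>
        (\<forall>B\<in>sets borel. B \<subseteq> G \<longrightarrow> emeasure M B = ennreal (\<mu> v v B))))"

definition mu_d :: "'a::topological_space measure \<Rightarrow> ('a \<Rightarrow> real) set \<Rightarrow>
    (('a \<Rightarrow> real) \<Rightarrow> ('a \<Rightarrow> real) \<Rightarrow> real) \<Rightarrow> ('a \<times> 'a) measure \<Rightarrow>
    (('a \<Rightarrow> real) \<Rightarrow> ('a \<Rightarrow> real) \<Rightarrow> 'a set \<Rightarrow> real) \<Rightarrow> ('a \<Rightarrow> real) \<Rightarrow> 'a set \<Rightarrow> ennreal" where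
  "mu_d m \<D> \<E> J \<mu> u B = mu_b m \<D> \<E> J u B + emeasure (mu_c m \<D> \<mu> u) B"

text \<open>The condition \<open>local\<close> is the consistency that makes \<open>mu_c\<close> well defined. Strong locality
  alone does not give it: pushing all values of \<open>\<mu>\<close> forward along a fixed homeomorphism of \<open>X\<close>
  preserves strong locality, positivity and total masses. The formula is required for every
  quasi-continuous version of \<open>u\<close>; this forces \<open>J\<close> and \<open>k\<close> not to charge sets of capacity zero, so
  that \<open>mu_b\<close> does not depend on the choice made in \<open>qc_rep\<close>.\<close>

locale beurling_deny = regular_dirichlet_form m \<D> \<E>
  for m :: "'a::{metric_space,second_countable_topology} measure"
    and \<D> :: "('a \<Rightarrow> real) set"
    and \<E> :: "('a \<Rightarrow> real) \<Rightarrow> ('a \<Rightarrow> real) \<Rightarrow> real" +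
  fixes J :: "('a \<times> 'a) measure"
    and \<mu> :: "('a \<Rightarrow> real) \<Rightarrow> ('a \<Rightarrow> real) \<Rightarrow> 'a set \<Rightarrow> real"
    and k :: "'a measure"
  assumes k_radon: "radon_measure k"
    and J_radon: "radon_on (- Id) J"
    and J_sym: "\<And>B. B \<in> sets J \<Longrightarrow> emeasure J (prod.swap ` B) = emeasure J B"
    and signed_radon: "\<And>u v. u \<in> \<D> \<Longrightarrow> v \<in> \<D> \<Longrightarrow> signed_radon_measure (\<mu> u v)"
    and add: "\<And>u v w B. u \<in> \<D> \<Longrightarrow> v \<in> \<D> \<Longrightarrow> w \<in> \<D> \<Longrightarrow> B \<in> sets borel \<Longrightarrow> rel_compact B \<Longrightarrow>
       \<mu> (\<lambda>x. u x + v x) w B = \<mu> u w B + \<mu> v w B"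
    and scale: "\<And>c u w B. u \<in> \<D> \<Longrightarrow> w \<in> \<D> \<Longrightarrow> B \<in> sets borel \<Longrightarrow> rel_compact B \<Longrightarrow>
       \<mu> (\<lambda>x. c * u x) w B = c * \<mu> u w B"
    and sym: "\<And>u v B. u \<in> \<D> \<Longrightarrow> v \<in> \<D> \<Longrightarrow> B \<in> sets borel \<Longrightarrow> rel_compact B \<Longrightarrow> \<mu> u v B = \<mu> v u B"
    and nonneg: "\<And>u B. u \<in> \<D> \<Longrightarrow> B \<in> sets borel \<Longrightarrow> rel_compact B \<Longrightarrow> \<mu> u u B \<ge> 0"
    and strongly_local: "\<And>u v c B. u \<in> \<D> \<Longrightarrow> v \<in> \<D> \<Longrightarrow>
       AE x in m. x \<in> ae_support m v \<longrightarrow> u x = c \<Longrightarrow>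
       B \<in> sets borel \<Longrightarrow> rel_compact B \<Longrightarrow> \<mu> u v B = 0"
    and local: "\<And>u v G B. u \<in> \<D> \<Longrightarrow> v \<in> \<D> \<Longrightarrow> open G \<Longrightarrow> rel_compact G \<Longrightarrow>
       AE x in m. x \<in> G \<longrightarrow> u x = v x \<Longrightarrow> B \<in> sets borel \<Longrightarrow> B \<subseteq> G \<Longrightarrow> \<mu> u u B = \<mu> v v B"
    and formula: "\<And>u v. u \<in> \<D> \<Longrightarrow> qc_version m \<D> \<E> u v \<Longrightarrow>
       ennreal (\<E> u u) =
         (\<integral>\<^sup>+p. ennreal ((v (fst p) - v (snd p))\<^sup>2) \<partial>J)
         + emeasure (mu_c m \<D> \<mu> u) UNIV
         + (\<integral>\<^sup>+x. ennreal ((v x)\<^sup>2) \<partial>k)"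

definition pseudo_metric :: "('a \<Rightarrow> 'a \<Rightarrow> ennreal) \<Rightarrow> bool" where
  "pseudo_metric \<rho> \<longleftrightarrow> (\<forall>x. \<rho> x x = 0) \<and> (\<forall>x y. \<rho> x y = \<rho> y x) \<and>
     (\<forall>x y z. \<rho> x z \<le> \<rho> x y + \<rho> y z)"

text \<open>The function \<open>\<rho>\<^sub>A \<and> T\<close>; for empty \<open>A\<close> the infimum is \<open>\<infinity>\<close> and the function is constant \<open>T\<close>.\<close>

definition dist_trunc :: "('a \<Rightarrow> 'a \<Rightarrow> ennreal) \<Rightarrow> 'a set \<Rightarrow> real \<Rightarrow> 'a \<Rightarrow> real" where
  "dist_trunc \<rho> A T x = enn2real (min (INF y\<in>A. \<rho> x y) (ennreal T))"

definition intrinsic_metric :: "'a::topological_space measure \<Rightarrow> ('a \<Rightarrow> real) set \<Rightarrow>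
    (('a \<Rightarrow> real) \<Rightarrow> ('a \<Rightarrow> real) \<Rightarrow> real) \<Rightarrow> ('a \<times> 'a) measure \<Rightarrow>
    (('a \<Rightarrow> real) \<Rightarrow> ('a \<Rightarrow> real) \<Rightarrow> 'a set \<Rightarrow> real) \<Rightarrow> ('a \<Rightarrow> 'a \<Rightarrow> ennreal) \<Rightarrow> bool" where
  "intrinsic_metric m \<D> \<E> J \<mu> \<rho> \<longleftrightarrow> pseudo_metric \<rho> \<and>
     (\<exists>m\<^sub>b m\<^sub>c. radon_measure m\<^sub>b \<and> radon_measure m\<^sub>c \<and>
        (\<forall>B\<in>sets borel. emeasure m\<^sub>b B + emeasure m\<^sub>c B \<le> emeasure m B) \<and>
        (\<forall>A. \<forall>T>0. dist_trunc \<rho> A T \<in> D_loc_star m \<D> \<E> J \<and>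
           continuous_on UNIV (dist_trunc \<rho> A T) \<and>
           (\<forall>B\<in>sets borel. mu_b m \<D> \<E> J (dist_trunc \<rho> A T) B \<le> emeasure m\<^sub>b B) \<and>
           (\<forall>B\<in>sets borel. emeasure (mu_c m \<D> \<mu> (dist_trunc \<rho> A T)) B \<le> emeasure m\<^sub>c B)))"

end

theory Submission
  imports Defs
begin

text \<open>Call a function \<^emph>\<open>1-Lipschitz\<close> if it satisfies the hypothesis
\<open>\<bar>u x - u y\<bar> \<le> \<rho> x y\<close>. Such a function is continuous, since \<open>\<rho>\<close> is small near the
diagonal. The two halves of \<open>\<mu>\<^sup>d\<close> are then estimated separately, by \<open>m\<^sub>b\<close> and by \<open>m\<^sub>c\<close>.

\<^emph>\<open>Jump part.\<close> If \<open>A\<close> is a set of small \<open>\<rho>\<close>-diameter, then for \<open>x \<in> A\<close> the increment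
\<open>\<bar>u x - u y\<bar>\<close> exceeds \<open>\<rho>\<^sub>A y = \<rho>\<^sub>A y - \<rho>\<^sub>A x\<close> at most by a small constant. Covering \<open>X\<close> by
countably many such sets and using the hypothesis on \<open>\<rho>\<^sub>A \<and> T\<close> for each of them gives
\<open>\<mu>\<^sup>b(u) \<le> m\<^sub>b\<close> in the limit (\<open>lipschitz_mu_b\<close>). This needs that \<open>J\<close> does not see the difference
between a continuous function and its chosen quasi-continuous version (\<open>J_not_charges\<close>).

\<^emph>\<open>Diffusion part.\<close> A bounded 1-Lipschitz function \<open>U\<close>, with \<open>0 \<le> U < M\<close>, is approximated
uniformly by a staircase of distance functions, namely the sum over \<open>i < N\<close> of
\<open>\<rho>\<^sub>A \<and> T\<close> with \<open>A = {U \<le> i M / N}\<close> and \<open>T = M / (N + 1)\<close>. As \<open>T\<close> is smaller than the width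
\<open>M / N\<close> of a layer, each summand is already constant before the next one starts to grow. So
every point has a neighbourhood on which at most one summand is not constant, and locality
yields \<open>\<mu>\<^sup>c \<le> m\<^sub>c\<close> for the staircase (\<open>staircase_mu_c\<close>). A third of the staircase
is 1-Lipschitz, which bounds its jump energy independently of \<open>N\<close> (\<open>staircase_lipschitz\<close>).

\<^emph>\<open>Passage to the limit.\<close> Cutting the staircases off by the minimum with some \<open>\<psi>\<close> in
\<open>\<D> \<inter> C\<^sub>c(X)\<close> produces functions of \<open>\<D>\<close> with bounded energy (\<open>energy_truncation_le\<close>).
Functions of bounded energy that also obey the bound on \<open>\<mu>\<^sup>c\<close> form convex sets, and nearly
energy-minimal elements of a decreasing sequence of bounded convex sets form a Cauchy sequence by
the parallelogram law (\<open>decreasing_convex_limit\<close>). Since \<open>\<D>\<close> is complete, the limit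
\<open>U \<and> \<psi>\<close> is in \<open>\<D>\<close> and inherits the bound (\<open>energy_closure\<close>). Where \<open>\<psi> \<ge> M\<close> it coincides with
\<open>U\<close>, and \<open>U\<close> can be chosen as \<open>u\<close> plus a constant on any given relatively compact open set.\<close>

section \<open>Relatively compact sets and cutoff functions\<close>

lemma rel_compact_subset:
  fixes A B :: "'a::t2_space set"
  assumes "rel_compact B" "A \<subseteq> B"
  shows "rel_compact A"
  using assms unfolding rel_compact_def
  by (metis closed_closure closure_mono compact_Int_closed inf.absorb_iff2)

lemma rel_compact_finite_Union:
  assumes "finite F" "\<And>A. A \<in> F \<Longrightarrow> rel_compact A"
  shows "rel_compact (\<Union>F)"
  using assms unfolding rel_compact_def
  by (induction F) auto

lemma compact_imp_rel_compact:
  fixes K :: "'a::t2_space set"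
  shows "compact K \<Longrightarrow> rel_compact K"
  unfolding rel_compact_def by (simp add: closure_closed compact_imp_closed)

lemma rel_compact_neighbourhood:
  fixes x :: "'a::t2_space"
  assumes "locally compact (UNIV :: 'a set)"
  obtains U where "open U" "rel_compact U" "x \<in> U"
proof -
  obtain u v where uv: "openin (top_of_set UNIV) u" "compact v" "x \<in> u" "u \<subseteq> v"
    using assms[unfolded locally_def, rule_format, of UNIV x] by auto
  show ?thesis
  proof (rule that)
    show "open u" using uv(1) by simp
    show "rel_compact u"
      using rel_compact_subset[OF compact_imp_rel_compact[OF uv(2)] uv(4)] .
  qed (fact uv(3))
qed

lemma compact_subset_open_rel_compact:
  fixes K :: "'a::t2_space set"
  assumes lc: "locally compact (UNIV :: 'a set)" and K: "compact K"
  obtains G where "open G" "rel_compact G" "K \<subseteq> G"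
proof -
  have cover: "K \<subseteq> \<Union>{U. open U \<and> rel_compact U}"
    using rel_compact_neighbourhood[OF lc] by blast
  obtain F where "F \<subseteq> {U. open U \<and> rel_compact U}" "finite F" "K \<subseteq> \<Union>F"
    using compactE[OF K cover] by blast
  moreover from this have "rel_compact (\<Union>F)"
    using rel_compact_finite_Union[of F] by blast
  moreover have "open (\<Union>F)" using calculation by blast
  moreover have "K \<subseteq> \<Union>F" by fact
  ultimately show ?thesis using that by blast
qed

lemma rel_compact_exhaustion:
  assumes lc: "locally compact (UNIV :: 'a::{metric_space,second_countable_topology} set)"
  obtains G :: "nat \<Rightarrow> 'a::{metric_space,second_countable_topology} set" where "\<And>n. open (G n)" "\<And>n. rel_compact (G n)" "(\<Union>n. G n) = UNIV"
proof -
  obtain F where F: "F \<subseteq> {U :: 'a set. open U \<and> rel_compact U}" "countable F"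
      "\<Union>F = \<Union>{U :: 'a set. open U \<and> rel_compact U}"
    by (rule Lindelof[of "{U :: 'a set. open U \<and> rel_compact U}"]) auto
  have "x \<in> \<Union>F" for x
    unfolding F(3) by (rule rel_compact_neighbourhood[OF lc, of x]) blast
  then have un: "\<Union>F = UNIV" by blast
  then have ne: "F \<noteq> {}" by auto
  show ?thesis
  proof (rule that[of "from_nat_into F"])
    fix n
    show "open (from_nat_into F n)" "rel_compact (from_nat_into F n)"
      using F(1) from_nat_into[OF ne, of n] by auto
    show "(\<Union>n. from_nat_into F n) = UNIV"
      using un range_from_nat_into[OF ne F(2)] by simp
  qed
qed

text \<open>The value \<open>2\<close> leaves room for a uniform approximation with error below \<open>1\<close>, which is all that
the density of \<open>\<D> \<inter> C\<^sub>c(X)\<close> in \<open>C\<^sub>c(X)\<close> provides.\<close>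

lemma Cc_bump_function:
  fixes K :: "'a::metric_space set"
  assumes lc: "locally compact (UNIV :: 'a set)" and K: "compact K"
  obtains f where "f \<in> Cc" "\<And>x. x \<in> K \<Longrightarrow> f x \<ge> (2::real)"
proof -
  obtain G where G: "open G" "rel_compact G" "K \<subseteq> G"
    using compact_subset_open_rel_compact[OF lc K] .
  show ?thesis
  proof (cases "G = UNIV")
    case True
    have "closure {x::'a. (2::real) \<noteq> 0} = closure G" by (simp add: True)
    then show ?thesis
      using G(2) by (intro that[of "\<lambda>_. 2"]) (auto simp: Cc_def rel_compact_def)
  next
    case False
    then have ne: "- G \<noteq> {}" by auto
    have cl: "closed (- G)" using G(1) by auto
    have "\<exists>d>0. \<forall>x\<in>K. infdist x (- G) \<ge> d"
    proof (cases "K = {}")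
      case Kne: False
      obtain a where a: "a \<in> K" "\<And>x. x \<in> K \<Longrightarrow> infdist a (- G) \<le> infdist x (- G)"
        using continuous_attains_inf[OF K Kne, of "\<lambda>x. infdist x (- G)"]
          continuous_on_infdist[OF continuous_on_id, of K "- G"] by blast
      have "infdist a (- G) > 0"
        using a(1) G(3) ne cl by (metis ComplD in_closed_iff_infdist_zero infdist_nonneg
            less_eq_real_def subsetD)
      with a show ?thesis by auto
    qed (auto intro: exI[of _ 1])
    then obtain d where d: "d > 0" "\<And>x. x \<in> K \<Longrightarrow> infdist x (- G) \<ge> d" by blast
    let ?f = "\<lambda>x. 2 / d * infdist x (- G)"
    have "?f x = 0" if "x \<notin> G" for x using infdist_zero[of x "- G"] that by simp
    then have "{x. ?f x \<noteq> 0} \<subseteq> G" by blast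
    then have "rel_compact {x. ?f x \<noteq> 0}" using rel_compact_subset[OF G(2)] by blast
    moreover have "continuous_on UNIV ?f" by (intro continuous_intros)
    ultimately have "?f \<in> Cc" unfolding Cc_def rel_compact_def by blast
    moreover have "?f x \<ge> 2" if "x \<in> K" for x
      using d(2)[OF that] d(1) by (simp add: pos_le_divide_eq)
    ultimately show ?thesis by (rule that)
  qed
qed

lemma ae_support_subset: "ae_support m v \<subseteq> closure {x. v x \<noteq> 0}"
proof
  fix x assume x: "x \<in> ae_support m v"
  obtain U where U: "U = - closure {x. v x \<noteq> 0}" by simp
  then have "\<forall>y\<in>U. v y = 0" "open U" using closure_subset[of "{x. v x \<noteq> 0}"] by blast+
  moreover from this have "AE y in m. y \<in> U \<longrightarrow> v y = 0" by (intro AE_I2) blast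
  ultimately have "x \<notin> U" using x unfolding ae_support_def by blast
  then show "x \<in> closure {x. v x \<noteq> 0}" using U by blast
qed

text \<open>The definition asks for additivity inside a compact set; the closure of a relatively compact set
is one.\<close>

lemma signed_radon_countable:
  assumes "signed_radon_measure \<nu>" "\<And>i::nat. A i \<in> sets borel" "disjoint_family A"
    "(\<Union>i. A i) \<subseteq> B" "rel_compact B"
  shows "(\<lambda>i. \<nu> (A i)) sums \<nu> (\<Union>i. A i)"
proof -
  have "(\<Union>i. A i) \<subseteq> closure B" using assms(4) closure_subset by blast
  moreover have "compact (closure B)" using assms(5) by (simp add: rel_compact_def)
  ultimately show ?thesis
    using assms(1-3) unfolding signed_radon_measure_def
    by (meson image_subset_iff)
qed

lemma signed_radon_empty:
  assumes "signed_radon_measure \<nu>" shows "\<nu> {} = 0"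
proof -
  have "(\<lambda>i::nat. \<nu> {}) sums \<nu> {}"
    using signed_radon_countable[OF assms, of "\<lambda>_. {}" "{}"]
    by (auto simp: disjoint_family_on_def rel_compact_def)
  then show ?thesis
    by (metis sums_summable summable_const_iff)
qed

section \<open>Non-negative forms on the domain\<close>

context regular_dirichlet_form
begin

text \<open>The calculus of quadratic forms below is used for three forms: \<open>\<E>\<close>, \<open>\<E>\<^sub>1\<close>, and \<open>\<mu>(\<cdot>,\<cdot>)(B)\<close> for a
fixed relatively compact Borel set \<open>B\<close>.\<close>

definition psd_form :: "(('a \<Rightarrow> real) \<Rightarrow> ('a \<Rightarrow> real) \<Rightarrow> real) \<Rightarrow> bool" where
  "psd_form q \<longleftrightarrow>
     (\<forall>u\<in>\<D>. \<forall>v\<in>\<D>. \<forall>w\<in>\<D>. q (\<lambda>x. u x + v x) w = q u w + q v w) \<and>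
     (\<forall>c. \<forall>u\<in>\<D>. \<forall>w\<in>\<D>. q (\<lambda>x. c * u x) w = c * q u w) \<and>
     (\<forall>u\<in>\<D>. \<forall>v\<in>\<D>. q u v = q v u) \<and> (\<forall>u\<in>\<D>. q u u \<ge> 0)"

lemma diff_mem: "u \<in> \<D> \<Longrightarrow> v \<in> \<D> \<Longrightarrow> (\<lambda>x. u x - v x) \<in> \<D>"
  using add_mem[of u "\<lambda>x. (-1) * v x"] scale_mem[of v "-1"] by simp

lemma sum_mem: "finite I \<Longrightarrow> (\<And>i. i \<in> I \<Longrightarrow> f i \<in> \<D>) \<Longrightarrow> (\<lambda>x. \<Sum>i\<in>I. f i x) \<in> \<D>"
  by (induction I rule: finite_induct) (auto simp: zero_mem intro: add_mem)

lemma contraction_mem: "normal_contraction T \<Longrightarrow> u \<in> \<D> \<Longrightarrow> (\<lambda>x. T (u x)) \<in> \<D>"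
  using contraction[of T u] by (simp add: comp_def)

lemma pos_part_mem: "u \<in> \<D> \<Longrightarrow> (\<lambda>x. max 0 (u x)) \<in> \<D>"
  by (rule contraction_mem) (auto simp: normal_contraction_def)

lemma min_mem: assumes "u \<in> \<D>" "v \<in> \<D>" shows "(\<lambda>x. min (u x) (v x)) \<in> \<D>"
proof -
  have "(\<lambda>x. u x - max 0 (u x - v x)) \<in> \<D>"
    using assms by (intro diff_mem pos_part_mem)
  moreover have "(\<lambda>x. u x - max 0 (u x - v x)) = (\<lambda>x. min (u x) (v x))" by auto
  ultimately show ?thesis by simp
qed

context
  fixes q assumes q: "psd_form q"
begin

lemma psd_addL: "u \<in> \<D> \<Longrightarrow> v \<in> \<D> \<Longrightarrow> w \<in> \<D> \<Longrightarrow> q (\<lambda>x. u x + v x) w = q u w + q v w"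
  and psd_scaleL: "u \<in> \<D> \<Longrightarrow> w \<in> \<D> \<Longrightarrow> q (\<lambda>x. c * u x) w = c * q u w"
  and psd_sym: "u \<in> \<D> \<Longrightarrow> v \<in> \<D> \<Longrightarrow> q u v = q v u"
  and psd_nonneg: "u \<in> \<D> \<Longrightarrow> q u u \<ge> 0"
  using q unfolding psd_form_def by blast+

lemma psd_scale: "u \<in> \<D> \<Longrightarrow> q (\<lambda>x. c * u x) (\<lambda>x. c * u x) = c\<^sup>2 * q u u"
  using psd_scaleL[of u "\<lambda>x. c * u x" c] psd_scaleL[of u u c] psd_sym[of u "\<lambda>x. c * u x"]
    scale_mem[of u c] by (simp add: power2_eq_square)

lemma psd_zero: "q (\<lambda>x. 0) (\<lambda>x. 0) = 0"
  using psd_scale[OF zero_mem, of 0] by simp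

lemma psd_add:
  assumes u: "u \<in> \<D>" and v: "v \<in> \<D>"
  shows "q (\<lambda>x. u x + v x) (\<lambda>x. u x + v x) = q u u + 2 * q u v + q v v"
proof -
  have w: "(\<lambda>x. u x + v x) \<in> \<D>" using u v by (rule add_mem)
  have "q (\<lambda>x. u x + v x) (\<lambda>x. u x + v x) = q (\<lambda>x. u x + v x) u + q (\<lambda>x. u x + v x) v"
    using psd_addL[OF u v w] psd_sym[OF u w] psd_sym[OF v w] by simp
  also have "\<dots> = q u u + 2 * q u v + q v v"
    using psd_addL[OF u v u] psd_addL[OF u v v] psd_sym[OF v u] by simp
  finally show ?thesis .
qed

lemma psd_add_scale:
  assumes u: "u \<in> \<D>" and v: "v \<in> \<D>"
  shows "q (\<lambda>x. u x + c * v x) (\<lambda>x. u x + c * v x) = q u u + 2 * c * q u v + c\<^sup>2 * q v v"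
  using psd_add[OF u scale_mem[OF v, of c]] psd_scale[OF v, of c] psd_scaleL[OF v u, of c]
    psd_sym[OF u v] psd_sym[OF u scale_mem[OF v, of c]] by simp

lemma psd_diff:
  assumes u: "u \<in> \<D>" and v: "v \<in> \<D>"
  shows "q (\<lambda>x. u x - v x) (\<lambda>x. u x - v x) = q u u - 2 * q u v + q v v"
  using psd_add_scale[OF u v, of "-1"] by simp

text \<open>Young's inequality. Taking \<open>t\<close> close to \<open>0\<close> keeps the constant in front of the first term close
to \<open>1\<close>, which matters when \<open>v\<close> is a vanishing perturbation of \<open>u\<close>.\<close>

lemma psd_add_le:
  assumes u: "u \<in> \<D>" and v: "v \<in> \<D>" and t: "t > 0"
  shows "q (\<lambda>x. u x + v x) (\<lambda>x. u x + v x) \<le> (1 + t) * q u u + (1 + 1 / t) * q v v"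
proof -
  have "0 \<le> q (\<lambda>x. v x + (-t) * u x) (\<lambda>x. v x + (-t) * u x)"
    using u v by (intro psd_nonneg add_mem scale_mem)
  then have "2 * t * q u v \<le> t\<^sup>2 * q u u + q v v"
    using psd_add_scale[OF v u, of "-t"] psd_sym[OF u v] by simp
  then have "2 * q u v \<le> t * q u u + q v v / t"
    using t by (simp add: field_simps power2_eq_square)
  then show ?thesis using psd_add[OF u v] by (simp add: algebra_simps)
qed

lemma psd_diff_le:
  assumes u: "u \<in> \<D>" and v: "v \<in> \<D>"
  shows "q (\<lambda>x. u x - v x) (\<lambda>x. u x - v x) \<le> 2 * q u u + 2 * q v v"
  using psd_add_le[OF u scale_mem[OF v, of "-1"], of 1] psd_scale[OF v, of "-1"] by simp

text \<open>The parallelogram law, in the form that compares a midpoint with its end points: sublevel sets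
of the form are convex, and points whose midpoint is not much lower are close.\<close>

lemma psd_midpoint:
  assumes u: "u \<in> \<D>" and v: "v \<in> \<D>"
  shows "q (\<lambda>x. (1/2) * (u x + v x)) (\<lambda>x. (1/2) * (u x + v x))
    = (q u u + q v v) / 2 - q (\<lambda>x. u x - v x) (\<lambda>x. u x - v x) / 4"
  using psd_scale[OF add_mem[OF u v], of "1/2"] psd_add[OF u v] psd_diff[OF u v]
  by (simp add: power2_eq_square field_simps)

text \<open>Cauchy-Schwarz for a null vector \<open>v\<close>: the form at \<open>u + c v\<close> is affine in \<open>c\<close>, hence constant if
it is bounded below.\<close>

lemma psd_null:
  assumes u: "u \<in> \<D>" and v: "v \<in> \<D>" and 0: "q v v = 0"
  shows "q u v = 0"
proof (rule ccontr)
  assume ne: "q u v \<noteq> 0"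
  \<comment> \<open>This choice makes the form equal to \<open>-1\<close>.\<close>
  define c where "c = - (q u u + 1) / (2 * q u v)"
  have "0 \<le> q (\<lambda>x. u x + c * v x) (\<lambda>x. u x + c * v x)"
    using u v by (intro psd_nonneg add_mem scale_mem)
  also have "\<dots> = q u u + 2 * c * q u v" using psd_add_scale[OF u v, of c] 0 by simp
  also have "\<dots> = -1" using ne by (simp add: c_def field_simps)
  finally show False by simp
qed

end

lemma psd_form_E: "psd_form \<E>"
  unfolding psd_form_def using form_add form_scale form_sym form_nonneg by blast

lemma L2D: "u \<in> \<D> \<Longrightarrow> u \<in> borel_measurable m" "u \<in> \<D> \<Longrightarrow> integrable m (\<lambda>x. (u x)\<^sup>2)"
  using subset_L2 by (auto simp: L2_def)

lemma integrable_mult: assumes "u \<in> \<D>" "v \<in> \<D>" shows "integrable m (\<lambda>x. u x * v x)"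
proof (rule Bochner_Integration.integrable_bound)
  show "integrable m (\<lambda>x. (u x)\<^sup>2 + (v x)\<^sup>2)" using L2D assms by auto
  show "(\<lambda>x. u x * v x) \<in> borel_measurable m" using L2D(1) assms by measurable
  have "\<bar>a * b\<bar> \<le> a\<^sup>2 + b\<^sup>2" for a b :: real
  proof -
    have "2 * (\<bar>a\<bar> * \<bar>b\<bar>) \<le> a\<^sup>2 + b\<^sup>2"
      using sum_squares_bound[of "\<bar>a\<bar>" "\<bar>b\<bar>"] by simp
    moreover have "0 \<le> \<bar>a\<bar> * \<bar>b\<bar>" by simp
    ultimately show ?thesis unfolding abs_mult by linarith
  qed
  then show "AE x in m. norm (u x * v x) \<le> norm ((u x)\<^sup>2 + (v x)\<^sup>2)" by simp
qed

lemma E1_eq: "E1 m \<E> u = \<E> u u + (\<integral>x. u x * u x \<partial>m)"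
  by (simp add: E1_def L2_norm_def power2_eq_square)

lemma psd_form_E1: "psd_form (\<lambda>u v. \<E> u v + (\<integral>x. u x * v x \<partial>m))"
  unfolding psd_form_def
  by (auto simp: form_add form_scale form_sym form_nonneg integrable_mult distrib_right
      mult.assoc mult.commute algebra_simps)

lemma E1_nonneg: "u \<in> \<D> \<Longrightarrow> E1 m \<E> u \<ge> 0"
  using psd_nonneg[OF psd_form_E1] by (simp add: E1_eq)

lemma energy_le_E1: "\<E> u u \<le> E1 m \<E> u"
  by (simp add: E1_eq)

lemma L2_le_E1: "u \<in> \<D> \<Longrightarrow> (\<integral>x. (u x)\<^sup>2 \<partial>m) \<le> E1 m \<E> u"
  by (simp add: E1_eq form_nonneg power2_eq_square)

text \<open>Let \<open>d n\<close> be the infimum of \<open>\<E>\<^sub>1\<close> on \<open>C n\<close>; it increases and is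
bounded, hence converges. If \<open>h n\<close> nearly attains \<open>d n\<close> and \<open>i \<le> j\<close>, then the midpoint of \<open>h i\<close> and
\<open>h j\<close> lies in \<open>C i\<close>, so its energy is at least \<open>d i\<close>, and the parallelogram law bounds
\<open>\<E>\<^sub>1(h i - h j)\<close> by \<open>2 (d j - d i)\<close> plus a null sequence.\<close>

lemma decreasing_convex_limit:
  assumes C: "\<And>n. C n \<subseteq> \<D>" "\<And>n. C n \<noteq> {}" "decseq C"
    and mid: "\<And>n u v. u \<in> C n \<Longrightarrow> v \<in> C n \<Longrightarrow> (\<lambda>x. (1/2) * (u x + v x)) \<in> C n"
    and bd: "\<And>u n. u \<in> C n \<Longrightarrow> E1 m \<E> u \<le> c"
  obtains h u where "\<And>n. h n \<in> C n" "u \<in> \<D>" "(\<lambda>n. E1 m \<E> (\<lambda>x. h n x - u x)) \<longlonglongrightarrow> 0"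
proof -
  define d where "d n = (INF u\<in>C n. E1 m \<E> u)" for n
  have bb: "bdd_below (E1 m \<E> ` C n)" for n
    using C(1) E1_nonneg by (intro bdd_belowI[of _ 0]) blast
  have d_le: "d n \<le> E1 m \<E> u" if "u \<in> C n" for n u
    unfolding d_def using cINF_lower[OF bb that] .
  have "mono d"
    unfolding d_def using C(2,3) bb by (intro monoI cINF_superset_mono) (auto simp: decseq_def)
  then have inc: "incseq d" .
  have d_c: "d n \<le> c" for n
    using C(2)[of n] d_le bd by (meson all_not_in_conv order_trans)
  have conv: "convergent d"
  proof -
    obtain L where "d \<longlonglongrightarrow> L" by (rule incseq_convergent[OF inc]) (use d_c in blast)
    then show ?thesis by (rule convergentI)
  qed
  have "\<exists>u. u \<in> C n \<and> E1 m \<E> u < d n + inverse (real (Suc n))" for n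
  proof -
    have "\<exists>u\<in>C n. E1 m \<E> u < d n + inverse (real (Suc n))"
      using cINF_less_iff[OF C(2) bb, of n "d n + inverse (real (Suc n))"]
      unfolding d_def by simp
    then show ?thesis by blast
  qed
  then obtain h where h: "\<And>n. h n \<in> C n" "\<And>n. E1 m \<E> (h n) < d n + inverse (real (Suc n))"
    by metis
  have hD: "h n \<in> \<D>" for n using h(1) C(1) by blast
  have close: "E1 m \<E> (\<lambda>x. h i x - h j x) \<le> 2 * (d j - d i) + 4 * inverse (real (Suc i))"
    if "i \<le> j" for i j
  proof -
    have "h j \<in> C i" using h(1)[of j] C(3) that by (auto simp: decseq_def)
    then have "d i \<le> E1 m \<E> (\<lambda>x. (1/2) * (h i x + h j x))"
      using d_le mid h(1) by blast
    also have "\<dots> = (E1 m \<E> (h i) + E1 m \<E> (h j)) / 2 - E1 m \<E> (\<lambda>x. h i x - h j x) / 4"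
      using psd_midpoint[OF psd_form_E1 hD[of i] hD[of j]] by (simp only: E1_eq)
    finally have "E1 m \<E> (\<lambda>x. h i x - h j x) \<le> 2 * E1 m \<E> (h i) + 2 * E1 m \<E> (h j) - 4 * d i"
      by (simp add: field_simps)
    moreover have "inverse (real (Suc j)) \<le> inverse (real (Suc i))"
      using that by (intro le_imp_inverse_le) auto
    ultimately show ?thesis using h(2)[of i] h(2)[of j] by argo
  qed
  have sym: "E1 m \<E> (\<lambda>x. h i x - h j x) = E1 m \<E> (\<lambda>x. h j x - h i x)" for i j
    using psd_diff[OF psd_form_E1 hD[of i] hD[of j]] psd_diff[OF psd_form_E1 hD[of j] hD[of i]]
      psd_sym[OF psd_form_E1 hD[of i] hD[of j]] by (simp only: E1_eq)
  have "\<exists>N. \<forall>i\<ge>N. \<forall>j\<ge>N. sqrt (E1 m \<E> (\<lambda>x. h i x - h j x)) < e" if e: "e > 0" for e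
  proof -
    have "Cauchy d" using conv by (rule convergent_Cauchy)
    then obtain N1 where N1: "\<And>i j. i \<ge> N1 \<Longrightarrow> j \<ge> N1 \<Longrightarrow> \<bar>d i - d j\<bar> < e\<^sup>2 / 4"
      using e unfolding Cauchy_def dist_real_def by (metis zero_less_divide_iff zero_less_numeral zero_less_power)
    have "(\<lambda>n. inverse (real (Suc n))) \<longlonglongrightarrow> 0" by (rule LIMSEQ_inverse_real_of_nat)
    then have "eventually (\<lambda>n. inverse (real (Suc n)) < e\<^sup>2 / 8) sequentially"
      using e by (intro order_tendstoD(2)) auto
    then obtain N2 where N2: "\<And>i. i \<ge> N2 \<Longrightarrow> inverse (real (Suc i)) < e\<^sup>2 / 8"
      by (auto simp: eventually_sequentially)
    have key: "E1 m \<E> (\<lambda>x. h i x - h j x) < e\<^sup>2" if "i \<ge> max N1 N2" "j \<ge> i" for i j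
    proof -
      have "N1 \<le> j" "N1 \<le> i" "N2 \<le> i" using that by auto
      moreover have "x < s" if "\<bar>p - q\<bar> < s / 4" "r < s / 8" "x \<le> 2 * (p - q) + 4 * r"
        for p q r s x :: real
        using that(1)[THEN order_le_less_trans[OF abs_ge_self]] that(2,3) by simp
      ultimately show ?thesis using N1 N2 close[OF that(2)] by blast
    qed
    have "sqrt (E1 m \<E> (\<lambda>x. h i x - h j x)) < e" if "i \<ge> max N1 N2" "j \<ge> max N1 N2" for i j
    proof -
      have "E1 m \<E> (\<lambda>x. h i x - h j x) < e\<^sup>2"
        using key[of i j] key[of j i] sym[of i j] that by (cases "i \<le> j") auto
      then show ?thesis using e real_less_lsqrt by fastforce
    qed
    then show ?thesis by blast
  qed
  then obtain u where u: "u \<in> \<D>" "(\<lambda>n. sqrt (E1 m \<E> (\<lambda>x. h n x - u x))) \<longlonglongrightarrow> 0"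
    using closed_form[of h] hD by blast
  have "(\<lambda>n. (sqrt (E1 m \<E> (\<lambda>x. h n x - u x)))\<^sup>2) \<longlonglongrightarrow> 0\<^sup>2" using u(2) by (rule tendsto_power)
  then have "(\<lambda>n. E1 m \<E> (\<lambda>x. h n x - u x)) \<longlonglongrightarrow> 0"
    using E1_nonneg[OF diff_mem[OF hD u(1)]] by simp
  then show ?thesis using that h(1) u(1) by blast
qed

lemma cutoff:
  assumes lc: "locally compact (UNIV :: 'a set)" and K: "compact K"
  obtains \<phi> where "\<phi> \<in> \<D>" "\<phi> \<in> Cc" "\<And>x. 0 \<le> \<phi> x" "\<And>x. \<phi> x \<le> 1" "\<And>x. x \<in> K \<Longrightarrow> \<phi> x = 1"
proof -
  obtain f :: "'a \<Rightarrow> real" where f: "f \<in> Cc" "\<And>x. x \<in> K \<Longrightarrow> f x \<ge> 2"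
    by (rule Cc_bump_function[OF lc K]) blast
  obtain v where v: "v \<in> \<D>" "v \<in> Cc" "\<And>x. \<bar>f x - v x\<bar> < 1"
    using dense_Cc[OF f(1), of 1] by auto
  let ?T = "\<lambda>s::real. min 1 (max 0 s)"
  have nc: "normal_contraction ?T" by (auto simp: normal_contraction_def min_def max_def)
  show ?thesis
  proof (rule that[of "\<lambda>x. ?T (v x)"])
    show "(\<lambda>x. ?T (v x)) \<in> \<D>" by (rule contraction_mem[OF nc v(1)])
    have "rel_compact {x. ?T (v x) \<noteq> 0}"
      by (rule rel_compact_subset[of "{x. v x \<noteq> 0}"]) (use v(2) in \<open>auto simp: Cc_def rel_compact_def\<close>)
    then show "(\<lambda>x. ?T (v x)) \<in> Cc"
      using v(2) unfolding Cc_def rel_compact_def by (auto intro!: continuous_intros)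
    show "?T (v x) = 1" if "x \<in> K" for x
      using f(2)[OF that] v(3)[of x] by (auto simp: min_def max_def)
  qed auto
qed

section \<open>Quasi-continuous versions of continuous functions\<close>

lemma quasi_continuous_continuous:
  assumes "continuous_on UNIV v" shows "quasi_continuous m \<D> \<E> v"
  unfolding quasi_continuous_def
proof (intro allI impI)
  fix e :: real assume e: "e > 0"
  have "cap_open m \<D> \<E> {} \<le> ennreal (E1 m \<E> (\<lambda>x. 0))"
    unfolding cap_open_def by (intro INF_lower) (simp add: zero_mem)
  also have "\<dots> = 0" using psd_zero[OF psd_form_E] by (simp add: E1_eq)
  finally have "cap_open m \<D> \<E> {} < ennreal e" using e by (simp add: order_le_less_trans)
  then show "\<exists>U. open U \<and> cap_open m \<D> \<E> U < ennreal e \<and> continuous_on (- U) v"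
    using assms by (intro exI[of _ "{}"]) auto
qed

lemma qc_version_continuous: "continuous_on UNIV v \<Longrightarrow> qc_version m \<D> \<E> v v"
  by (simp add: qc_version_def quasi_continuous_continuous borel_measurable_continuous_onI)

lemma qc_rep_version: "continuous_on UNIV v \<Longrightarrow> qc_version m \<D> \<E> v (qc_rep m \<D> \<E> v)"
  unfolding qc_rep_def
  by (rule someI[where P = "qc_version m \<D> \<E> v"]) (rule qc_version_continuous)

text \<open>If \<open>v\<close> is continuous off the open set \<open>U\<close>, then adding the null set \<open>{v \<noteq> u}\<close> to \<open>U\<close> gives
an open set again, because \<open>v - u\<close> is continuous off \<open>U\<close>. The capacity stays the same, as it only
depends on conditions that hold almost everywhere. Therefore \<open>{v \<noteq> u}\<close> has capacity zero, and the
indicator of any Borel part of it is a quasi-continuous version of \<open>0\<close>.\<close>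

lemma null_version_quasi_continuous:
  assumes v: "qc_version m \<D> \<E> u v" and u: "continuous_on UNIV u"
    and N: "N \<in> sets borel" "N \<subseteq> {x. v x \<noteq> u x}"
  shows "qc_version m \<D> \<E> (\<lambda>x. 0) (indicator N)"
  unfolding qc_version_def
proof (intro conjI)
  have ae: "AE x in m. v x = u x" and qc: "quasi_continuous m \<D> \<E> v"
    using v by (auto simp: qc_version_def)
  show "(indicator N :: 'a \<Rightarrow> real) \<in> borel_measurable borel" using N(1) by simp
  show "AE x in m. indicator N x = (0::real)"
    using ae by eventually_elim (use N(2) in \<open>auto simp: indicator_def\<close>)
  show "quasi_continuous m \<D> \<E> (indicator N)"
    unfolding quasi_continuous_def
  proof (intro allI impI)
    fix e :: real assume "e > 0"
    then obtain U where U: "open U" "cap_open m \<D> \<E> U < ennreal e" "continuous_on (- U) v"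
      using qc unfolding quasi_continuous_def by blast
    define V where "V = U \<union> {x. v x \<noteq> u x}"
    have "continuous_on (- U) (\<lambda>x. v x - u x)"
      using U(3) u by (intro continuous_intros) (auto intro: continuous_on_subset)
    then have "closedin (top_of_set (- U)) (- U \<inter> (\<lambda>x. v x - u x) -` {0})"
      by (rule continuous_closedin_preimage) simp
    then have "closed (- U \<inter> (\<lambda>x. v x - u x) -` {0})"
      using U(1) closedin_closed_trans by blast
    moreover have "V = - (- U \<inter> (\<lambda>x. v x - u x) -` {0})" by (auto simp: V_def)
    ultimately have oV: "open V" by (simp only: open_closed double_complement)
    have "cap_open m \<D> \<E> V = cap_open m \<D> \<E> U"
    proof -
      have "(AE x in m. indicator V x \<le> w x) \<longleftrightarrow> (AE x in m. indicator U x \<le> w x)" for w :: "'a \<Rightarrow> real"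
      proof
        assume "AE x in m. indicator V x \<le> w x"
        then show "AE x in m. indicator U x \<le> w x"
          by eventually_elim (auto simp: V_def indicator_def split: if_splits)
      next
        assume "AE x in m. indicator U x \<le> w x"
        with ae show "AE x in m. indicator V x \<le> w x"
          by eventually_elim (auto simp: V_def indicator_def split: if_splits)
      qed
      then show ?thesis unfolding cap_open_def by simp
    qed
    moreover have "continuous_on (- V) (indicator N :: 'a \<Rightarrow> real)"
    proof -
      have "continuous_on (- V) (\<lambda>x. 0 :: real)" by simp
      then show ?thesis
        by (rule continuous_on_eq) (use N(2) in \<open>auto simp: V_def indicator_def\<close>)
    qed
    ultimately show "\<exists>U. open U \<and> cap_open m \<D> \<E> U < ennreal e \<and> continuous_on (- U) (indicator N :: 'a \<Rightarrow> real)"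
      using oV U(2) by auto
  qed
qed

end

section \<open>The jump measure and the construction of the energy measure\<close>

lemma suminf_ennreal_swap:
  fixes f :: "nat \<Rightarrow> nat \<Rightarrow> ennreal"
  shows "(\<Sum>i. \<Sum>j. f i j) = (\<Sum>j. \<Sum>i. f i j)"
proof -
  have "(\<Sum>i. \<Sum>j. f i j) = (\<Sum>i. \<integral>\<^sup>+j. f i j \<partial>count_space UNIV)"
    by (simp only: nn_integral_count_space_nat)
  also have "\<dots> = (\<integral>\<^sup>+j. (\<Sum>i. f i j) \<partial>count_space UNIV)"
    by (rule nn_integral_suminf[symmetric]) simp
  finally show ?thesis by (simp only: nn_integral_count_space_nat)
qed

text \<open>Estimates and identities between measures need only be checked on the pieces of a countable
partition; this is how every local statement about \<open>\<mu>\<^sup>c\<close> becomes a global one.\<close>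

lemma emeasure_disjoint_cover:
  fixes D :: "nat \<Rightarrow> 'a::topological_space set"
  assumes M: "sets M = sets borel" and D: "\<And>i. D i \<in> sets borel" "disjoint_family D" "(\<Union>i. D i) = UNIV"
    and B: "B \<in> sets borel"
  shows "emeasure M B = (\<Sum>i. emeasure M (B \<inter> D i))"
proof -
  have "(\<Sum>i. emeasure M (B \<inter> D i)) = emeasure M (\<Union>i. B \<inter> D i)"
    using M D(1) B by (intro suminf_emeasure disjoint_family_subset[OF D(2)]) auto
  also have "(\<Union>i. B \<inter> D i) = B" using D(3) by blast
  finally show ?thesis by simp
qed

locale lc_beurling_deny = beurling_deny m \<D> \<E> J \<mu> k
  for m :: "'a::{metric_space,second_countable_topology} measure"
    and \<D> :: "('a \<Rightarrow> real) set"
    and \<E> :: "('a \<Rightarrow> real) \<Rightarrow> ('a \<Rightarrow> real) \<Rightarrow> real"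
    and J :: "('a \<times> 'a) measure"
    and \<mu> :: "('a \<Rightarrow> real) \<Rightarrow> ('a \<Rightarrow> real) \<Rightarrow> 'a set \<Rightarrow> real"
    and k :: "'a measure" +
  assumes loc_compact: "locally compact (UNIV :: 'a set)"
    and m_radon: "radon_measure m"
begin

lemma sets_m: "sets m = sets borel"
  using m_radon by (simp add: radon_on_def)

lemma measurable_m: "u \<in> borel_measurable m \<longleftrightarrow> u \<in> borel_measurable borel"
  using measurable_cong_sets[OF sets_m refl] by blast

lemma space_J: "space J = - Id"
proof -
  have "sets J = sets (restrict_space borel (- Id))" using J_radon by (simp add: radon_on_def)
  then have "space J = space (restrict_space borel (- Id))" by (rule sets_eq_imp_space_eq)
  then show ?thesis by (simp add: space_restrict_space)
qed

lemma measurable_J: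
  assumes "f \<in> borel_measurable borel" shows "f \<in> borel_measurable J"
proof -
  have "sets J = sets (restrict_space borel (- Id))" using J_radon by (simp add: radon_on_def)
  then show ?thesis
    using measurable_restrict_space1[OF assms, of "- Id"] measurable_cong_sets by blast
qed

lemma measurable_fst_J:
  assumes "v \<in> borel_measurable borel" shows "(\<lambda>p. v (fst p)) \<in> borel_measurable J"
proof (rule measurable_J[OF measurable_compose[OF _ assms]])
  show "fst \<in> borel_measurable (borel :: ('a \<times> 'a) measure)"
    by (intro borel_measurable_continuous_onI continuous_on_fst continuous_on_id)
qed

lemma measurable_snd_J:
  assumes "v \<in> borel_measurable borel" shows "(\<lambda>p. v (snd p)) \<in> borel_measurable J"
proof (rule measurable_J[OF measurable_compose[OF _ assms]])
  show "snd \<in> borel_measurable (borel :: ('a \<times> 'a) measure)"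
    by (intro borel_measurable_continuous_onI continuous_on_snd continuous_on_id)
qed

lemma jump_measurable:
  assumes v: "v \<in> borel_measurable borel"
  shows "(\<lambda>p. ennreal ((v (fst p) - v (snd p))\<^sup>2)) \<in> borel_measurable J"
  using measurable_fst_J[OF v] measurable_snd_J[OF v] by measurable

text \<open>The energy formula holds for every quasi-continuous version. For \<open>0\<close> and the version \<open>1\<^sub>N'\<close>,
where \<open>N'\<close> is a Borel subset of \<open>N = {v \<noteq> u}\<close>, it says that \<open>J\<close>-almost every pair has both or
neither of its points in \<open>N'\<close>. Let \<open>N'\<close> run through the intersections of \<open>N\<close> with the sets of a
countable base: as these separate the two points of a pair off the diagonal, neither point is
in \<open>N\<close>.\<close>

lemma J_not_charges:
  assumes v: "qc_version m \<D> \<E> u v" and u: "continuous_on UNIV u"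
  shows "AE p in J. v (fst p) = u (fst p) \<and> v (snd p) = u (snd p)"
proof -
  obtain \<B> :: "'a set set" where \<B>: "countable \<B>" "\<And>b. b \<in> \<B> \<Longrightarrow> open b"
    and basis: "\<And>U x. open U \<Longrightarrow> x \<in> U \<Longrightarrow> \<exists>b\<in>\<B>. x \<in> b \<and> b \<subseteq> U"
    by (metis ex_countable_basis topological_basis_open topological_basisE)
  have vm: "v \<in> borel_measurable borel" using v by (simp add: qc_version_def)
  have um: "u \<in> borel_measurable borel" using u by (rule borel_measurable_continuous_onI)
  define N where "N = {x. v x \<noteq> u x}"
  have N: "N \<in> sets borel"
  proof -
    have "{x \<in> space borel. v x \<noteq> u x} \<in> sets borel" using vm um by measurable
    then show ?thesis by (simp add: N_def)
  qed
  have "AE p in J. indicator (N \<inter> b) (fst p) = (indicator (N \<inter> b) (snd p) :: real)" if b: "b \<in> \<B>" for b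
  proof -
    let ?i = "indicator (N \<inter> b) :: 'a \<Rightarrow> real"
    have Nb: "N \<inter> b \<in> sets borel" using N \<B>(2)[OF b] by auto
    have "qc_version m \<D> \<E> (\<lambda>x. 0) ?i"
      by (rule null_version_quasi_continuous[OF v u Nb]) (auto simp: N_def)
    then have "ennreal (\<E> (\<lambda>x. 0) (\<lambda>x. 0)) \<ge> (\<integral>\<^sup>+p. ennreal ((?i (fst p) - ?i (snd p))\<^sup>2) \<partial>J)"
      using formula[OF zero_mem] by (simp add: add.assoc)
    then have "(\<integral>\<^sup>+p. ennreal ((?i (fst p) - ?i (snd p))\<^sup>2) \<partial>J) = 0"
      using psd_zero[OF psd_form_E] by simp
    then have "AE p in J. ennreal ((?i (fst p) - ?i (snd p))\<^sup>2) = 0"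
      using nn_integral_0_iff_AE[OF jump_measurable[of ?i]] Nb by simp
    then show ?thesis by eventually_elim simp
  qed
  then have "AE p in J. \<forall>b\<in>\<B>. indicator (N \<inter> b) (fst p) = (indicator (N \<inter> b) (snd p) :: real)"
    by (intro AE_ball_countable[OF \<B>(1), THEN iffD2] ballI)
  moreover have "AE p in J. fst p \<noteq> snd p"
    by (rule AE_I2) (auto simp: space_J)
  ultimately show ?thesis
  proof eventually_elim
    case (elim p)
    have sep: "\<exists>b\<in>\<B>. x \<in> b \<and> y \<notin> b" if "x \<noteq> y" for x y
      using basis[of "- {y}" x] that by auto
    have "fst p \<notin> N"
      using sep[OF elim(2)] elim(1) by (auto simp: indicator_def split: if_splits)
    moreover have "snd p \<notin> N"
      using sep[OF elim(2)[symmetric]] elim(1) by (auto simp: indicator_def split: if_splits)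
    ultimately show ?case by (simp add: N_def)
  qed
qed

text \<open>For a continuous function the arbitrary choice of a quasi-continuous version disappears. The
diagonal drops out of the domain of integration, since \<open>J\<close> lives off it.\<close>

lemma mu_b_continuous:
  assumes u: "continuous_on UNIV u"
  shows "mu_b m \<D> \<E> J u B = (\<integral>\<^sup>+p. ennreal ((u (fst p) - u (snd p))\<^sup>2) * indicator B (fst p) \<partial>J)"
  unfolding mu_b_def
proof (rule nn_integral_cong_AE)
  have "AE p in J. p \<in> - Id" by (rule AE_I2) (simp add: space_J)
  with J_not_charges[OF qc_rep_version[OF u] u]
  show "AE p in J. ennreal ((qc_rep m \<D> \<E> u (fst p) - qc_rep m \<D> \<E> u (snd p))\<^sup>2)
      * indicator (B \<times> UNIV - Id) p = ennreal ((u (fst p) - u (snd p))\<^sup>2) * indicator B (fst p)"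
    by eventually_elim (auto simp: indicator_def split: if_splits)
qed

definition locally_in_D :: "('a \<Rightarrow> real) \<Rightarrow> bool" where
  "locally_in_D u \<longleftrightarrow>
     (\<forall>G. open G \<longrightarrow> rel_compact G \<longrightarrow> (\<exists>v\<in>\<D>. AE x in m. x \<in> G \<longrightarrow> u x = v x))"

lemma D_loc_iff: "u \<in> D_loc m \<D> \<longleftrightarrow> u \<in> L2_loc m \<and> locally_in_D u"
  by (auto simp: D_loc_def locally_in_D_def)

lemma D_locally_in_D: "u \<in> \<D> \<Longrightarrow> locally_in_D u"
  by (auto simp: locally_in_D_def)

lemma disjoint_rel_compact_cover:
  obtains G D :: "nat \<Rightarrow> 'a set" where "\<And>n. open (G n)" "\<And>n. rel_compact (G n)" "\<And>n. D n \<subseteq> G n"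
    "\<And>n. D n \<in> sets borel" "disjoint_family D" "(\<Union>n. D n) = UNIV"
proof -
  obtain G :: "nat \<Rightarrow> 'a set" where G: "\<And>n. open (G n)" "\<And>n. rel_compact (G n)" "(\<Union>n. G n) = UNIV"
    by (rule rel_compact_exhaustion[OF loc_compact]) blast
  have "range (disjointed G) \<subseteq> sets borel"
    by (rule sets.range_disjointed_sets) (use G(1) in auto)
  then show ?thesis
    by (intro that[of G "disjointed G"] G(1,2))
      (use G(3) in \<open>auto simp: disjoint_family_disjointed UN_disjointed_eq disjointed_subset[THEN subsetD]\<close>)
qed

text \<open>Existence: on the \<open>i\<close>-th piece \<open>D i\<close> of a partition into relatively compact sets take the energy
measure of a function of \<open>\<D>\<close> that agrees with \<open>u\<close> near this piece, and add up; locality makes the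
result independent of the choices. Uniqueness: the values on subsets of the pieces are prescribed.\<close>

lemma mu_c_unique_measure:
  assumes u: "locally_in_D u"
  shows "\<exists>!M. sets M = sets borel \<and>
     (\<forall>G v. open G \<and> rel_compact G \<and> v \<in> \<D> \<and> (AE x in m. x \<in> G \<longrightarrow> u x = v x) \<longrightarrow>
        (\<forall>B\<in>sets borel. B \<subseteq> G \<longrightarrow> emeasure M B = ennreal (\<mu> v v B)))"
proof -
  obtain G D :: "nat \<Rightarrow> 'a set" where G: "\<And>n. open (G n)" "\<And>n. rel_compact (G n)"
    and D: "\<And>n. D n \<subseteq> G n" "\<And>n. D n \<in> sets borel" "disjoint_family D" "(\<Union>n. D n) = UNIV"
    by (rule disjoint_rel_compact_cover) blast
  have "\<forall>n. \<exists>v. v \<in> \<D> \<and> (AE x in m. x \<in> G n \<longrightarrow> u x = v x)"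
    using u G unfolding locally_in_D_def by blast
  from choice[OF this] obtain w
    where "\<forall>n. w n \<in> \<D> \<and> (AE x in m. x \<in> G n \<longrightarrow> u x = w n x)" ..
  then have w: "\<And>n. w n \<in> \<D>" "\<And>n. AE x in m. x \<in> G n \<longrightarrow> u x = w n x" by auto
  have rc: "rel_compact (B \<inter> D i)" for B i using rel_compact_subset[OF G(2)[of i]] D(1)[of i] by blast
  define \<nu> where "\<nu> i B = ennreal (\<mu> (w i) (w i) (B \<inter> D i))" for i B
  define M where "M = measure_of UNIV (sets borel) (\<lambda>B. \<Sum>i. \<nu> i B)"
  have setsM: "sets M = sets borel"
    unfolding M_def using sets_measure_of[of "sets borel" UNIV] sets.sigma_sets_eq[of borel]
    unfolding space_borel by blast
  have \<nu>_add: "(\<Sum>j. \<nu> i (A j)) = \<nu> i (\<Union>j. A j)"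
    if A: "range A \<subseteq> sets borel" "disjoint_family A" for i and A :: "nat \<Rightarrow> 'a set"
  proof -
    have "(\<lambda>j. \<mu> (w i) (w i) (A j \<inter> D i)) sums \<mu> (w i) (w i) (\<Union>j. A j \<inter> D i)"
      by (rule signed_radon_countable[OF signed_radon[OF w(1) w(1)], where B = "G i"])
        (use A D(2) D(1)[THEN subsetD] G(2) in \<open>auto simp: disjoint_family_on_def\<close>)
    moreover have "(\<Union>j. A j \<inter> D i) = (\<Union>j. A j) \<inter> D i" by blast
    ultimately show ?thesis
      unfolding \<nu>_def using A D(2) rc w(1)
      by (intro suminf_ennreal_eq nonneg) auto
  qed
  have emM: "emeasure M B = (\<Sum>i. \<nu> i B)" if B: "B \<in> sets borel" for B
  proof (rule emeasure_measure_of[OF M_def])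
    show "sets borel \<subseteq> Pow (UNIV :: 'a set)" by simp
    show "B \<in> sets M" using B setsM by simp
    show "positive (sets M) (\<lambda>B. \<Sum>i. \<nu> i B)"
      by (simp add: positive_def \<nu>_def signed_radon_empty[OF signed_radon[OF w(1) w(1)]])
    show "countably_additive (sets M) (\<lambda>B. \<Sum>i. \<nu> i B)"
    proof (rule countably_additiveI)
      fix A :: "nat \<Rightarrow> 'a set" assume A: "range A \<subseteq> sets M" "disjoint_family A"
      have "(\<Sum>j. \<Sum>i. \<nu> i (A j)) = (\<Sum>i. \<Sum>j. \<nu> i (A j))" by (rule suminf_ennreal_swap)
      also have "\<dots> = (\<Sum>i. \<nu> i (\<Union>j. A j))" using \<nu>_add[of A] A setsM by simp
      finally show "(\<Sum>j. \<Sum>i. \<nu> i (A j)) = (\<Sum>i. \<nu> i (\<Union>j. A j))" .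
    qed
  qed
  show ?thesis
  proof (rule ex1I[of _ M], intro conjI allI impI ballI)
    show "sets M = sets borel" by (rule setsM)
  next
    fix H v B
    assume H: "open H \<and> rel_compact H \<and> v \<in> \<D> \<and> (AE x in m. x \<in> H \<longrightarrow> u x = v x)"
      and B: "B \<in> sets borel" "B \<subseteq> H"
    have "\<nu> i B = ennreal (\<mu> v v (B \<inter> D i))" for i
    proof -
      have "AE x in m. x \<in> H \<inter> G i \<longrightarrow> w i x = v x"
        using H[THEN conjunct2, THEN conjunct2, THEN conjunct2] w(2)[of i] by eventually_elim auto
      then have "\<mu> (w i) (w i) (B \<inter> D i) = \<mu> v v (B \<inter> D i)"
        using H G(1)[of i] B D(1,2)[of i] w(1)[of i] rel_compact_subset[of H "H \<inter> G i"]
        by (intro local[where G = "H \<inter> G i"]) auto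
      then show ?thesis by (simp add: \<nu>_def)
    qed
    then have "emeasure M B = (\<Sum>i. ennreal (\<mu> v v (B \<inter> D i)))" using emM[OF B(1)] by simp
    also have "\<dots> = ennreal (\<mu> v v (\<Union>i. B \<inter> D i))"
    proof (rule suminf_ennreal_eq)
      show "0 \<le> \<mu> v v (B \<inter> D i)" for i using H B(1) D(2) rc by (intro nonneg) auto
      have "(\<Union>i. B \<inter> D i) \<subseteq> H" using B(2) by blast
      then show "(\<lambda>i. \<mu> v v (B \<inter> D i)) sums \<mu> v v (\<Union>i. B \<inter> D i)"
        by (rule signed_radon_countable[rotated 3])
          (use H B(1) D(2,3) in \<open>auto simp: disjoint_family_on_def intro: signed_radon\<close>)
    qed
    also have "(\<Union>i. B \<inter> D i) = B" using D(4) by blast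
    finally show "emeasure M B = ennreal (\<mu> v v B)" .
  next
    fix M'
    assume M': "sets M' = sets borel \<and>
      (\<forall>G v. open G \<and> rel_compact G \<and> v \<in> \<D> \<and> (AE x in m. x \<in> G \<longrightarrow> u x = v x) \<longrightarrow>
        (\<forall>B\<in>sets borel. B \<subseteq> G \<longrightarrow> emeasure M' B = ennreal (\<mu> v v B)))"
    show "M' = M"
    proof (rule measure_eqI)
      show "sets M' = sets M" using M' setsM by simp
      fix B assume "B \<in> sets M'"
      then have B: "B \<in> sets borel" using M' by simp
      have piece: "emeasure M' (B \<inter> D i) = \<nu> i B" for i
      proof -
        have "B \<inter> D i \<in> sets borel" "B \<inter> D i \<subseteq> G i" using B D(1,2)[of i] by auto
        then show ?thesis unfolding \<nu>_def using M' G(1,2)[of i] w(1,2)[of i] by blast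
      qed
      have "emeasure M' B = (\<Sum>i. emeasure M' (B \<inter> D i))"
        by (rule emeasure_disjoint_cover) (use M' D(2-4) B in auto)
      then show "emeasure M' B = emeasure M B" using piece emM[OF B] by simp
    qed
  qed
qed

lemma sets_mu_c: "locally_in_D u \<Longrightarrow> sets (mu_c m \<D> \<mu> u) = sets borel"
  using theI'[OF mu_c_unique_measure[of u]] unfolding mu_c_def by blast

lemma emeasure_mu_c:
  assumes "locally_in_D u" "open G" "rel_compact G" "v \<in> \<D>" "AE x in m. x \<in> G \<longrightarrow> u x = v x"
    "B \<in> sets borel" "B \<subseteq> G"
  shows "emeasure (mu_c m \<D> \<mu> u) B = ennreal (\<mu> v v B)"
  using theI'[OF mu_c_unique_measure[OF assms(1)]] assms(2-) unfolding mu_c_def by blast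

end

section \<open>Locality of the energy measure\<close>

context lc_beurling_deny
begin

lemma psd_form_mu:
  assumes "B \<in> sets borel" "rel_compact B"
  shows "psd_form (\<lambda>u v. \<mu> u v B)"
  unfolding psd_form_def by (intro conjI ballI allI add scale sym nonneg assms)

text \<open>By locality \<open>\<phi>\<close> may be replaced by \<open>c g\<close> for a cutoff function \<open>g\<close>. Choose a second cutoff function
\<open>h\<close> that is \<open>1\<close> on the support of \<open>g\<close>. Then \<open>\<mu>(h,g) = 0\<close> by strong locality, while \<open>h - g = 0\<close> on \<open>G\<close>.
Hence \<open>0 = \<mu>(h - g) = \<mu>(h) + \<mu>(g)\<close> on \<open>G\<close>, and both terms vanish as they are non-negative.\<close>

lemma mu_locally_constant:
  assumes \<phi>: "\<phi> \<in> \<D>" and G: "open G" "rel_compact G" and c: "AE x in m. x \<in> G \<longrightarrow> \<phi> x = c"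
    and B: "B \<in> sets borel" "B \<subseteq> G"
  shows "\<mu> \<phi> \<phi> B = 0"
proof -
  have rcB: "rel_compact B" using G(2) B(2) by (rule rel_compact_subset)
  note q = psd_form_mu[OF B(1) rcB]
  obtain g where g: "g \<in> \<D>" "g \<in> Cc" "\<And>x. x \<in> closure G \<Longrightarrow> g x = 1"
    by (rule cutoff[OF loc_compact G(2)[unfolded rel_compact_def]]) blast
  have "compact (closure {x. g x \<noteq> 0})" using g(2) by (simp add: Cc_def)
  then obtain h where h: "h \<in> \<D>" "\<And>x. x \<in> closure {x. g x \<noteq> 0} \<Longrightarrow> h x = 1"
    by (rule cutoff[OF loc_compact]) blast
  have gG: "g x = 1" if "x \<in> G" for x using g(3) closure_subset that by blast
  have hG: "h x = 1" if "x \<in> G" for x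
  proof -
    have "x \<in> {x. g x \<noteq> 0}" using gG[OF that] by simp
    then show ?thesis by (rule h(2)[OF subsetD[OF closure_subset]])
  qed
  have "\<mu> h g B = 0"
    by (rule strongly_local[OF h(1) g(1) _ B(1) rcB, where c = 1])
      (rule AE_I2, rule impI, rule h(2)[OF subsetD[OF ae_support_subset]])
  moreover have "\<mu> (\<lambda>x. h x - g x) (\<lambda>x. h x - g x) B = \<mu> (\<lambda>x. 0) (\<lambda>x. 0) B"
    by (rule local[OF diff_mem[OF h(1) g(1)] zero_mem G _ B]) (simp add: gG hG)
  ultimately have "\<mu> h h B + \<mu> g g B = 0"
    using psd_diff[OF q h(1) g(1)] psd_zero[OF q] by simp
  then have "\<mu> g g B = 0" using psd_nonneg[OF q h(1)] psd_nonneg[OF q g(1)] by simp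
  moreover have "\<mu> \<phi> \<phi> B = \<mu> (\<lambda>x. c * g x) (\<lambda>x. c * g x) B"
    by (rule local[OF \<phi> scale_mem[OF g(1)] G _ B]) (use c in eventually_elim, auto simp: gG)
  ultimately show ?thesis using psd_scale[OF q g(1), of c] by simp
qed

text \<open>The difference \<open>w - v\<close> is a null vector of the form \<open>\<mu>(\<cdot>,\<cdot>)(B)\<close>, so that it does not contribute
to the mixed term either.\<close>

lemma mu_local_up_to_constant:
  assumes w: "w \<in> \<D>" "v \<in> \<D>" and G: "open G" "rel_compact G"
    and c: "AE x in m. x \<in> G \<longrightarrow> w x = v x + c" and B: "B \<in> sets borel" "B \<subseteq> G"
  shows "\<mu> w w B = \<mu> v v B"
proof -
  have rcB: "rel_compact B" using G(2) B(2) by (rule rel_compact_subset)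
  note q = psd_form_mu[OF B(1) rcB]
  have d: "(\<lambda>x. w x - v x) \<in> \<D>" using w by (rule diff_mem)
  have "\<mu> (\<lambda>x. w x - v x) (\<lambda>x. w x - v x) B = 0"
    by (rule mu_locally_constant[OF d G _ B, of c]) (use c in eventually_elim, auto)
  then show ?thesis using psd_add[OF q w(2) d] psd_null[OF q w(2) d] by simp
qed

lemma emeasure_mu_c_up_to_constant:
  assumes u: "locally_in_D u" and v: "locally_in_D v" and H: "open H"
    and c: "\<And>x. x \<in> H \<Longrightarrow> u x = v x + c" and B: "B \<in> sets borel" "B \<subseteq> H"
  shows "emeasure (mu_c m \<D> \<mu> u) B = emeasure (mu_c m \<D> \<mu> v) B"
proof -
  obtain G D :: "nat \<Rightarrow> 'a set" where G: "\<And>n. open (G n)" "\<And>n. rel_compact (G n)"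
    and D: "\<And>n. D n \<subseteq> G n" "\<And>n. D n \<in> sets borel" "disjoint_family D" "(\<Union>n. D n) = UNIV"
    by (rule disjoint_rel_compact_cover) blast
  have "emeasure (mu_c m \<D> \<mu> u) (B \<inter> D i) = emeasure (mu_c m \<D> \<mu> v) (B \<inter> D i)" for i
  proof -
    let ?G = "H \<inter> G i"
    have G': "open ?G" "rel_compact ?G"
      using H G(1)[of i] rel_compact_subset[OF G(2)[of i], of ?G] by auto
    have B': "B \<inter> D i \<in> sets borel" "B \<inter> D i \<subseteq> ?G" using B D(1,2)[of i] by auto
    obtain u' where u': "u' \<in> \<D>" "AE x in m. x \<in> ?G \<longrightarrow> u x = u' x"
      using u G' unfolding locally_in_D_def by blast
    obtain v' where v': "v' \<in> \<D>" "AE x in m. x \<in> ?G \<longrightarrow> v x = v' x"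
      using v G' unfolding locally_in_D_def by blast
    have "AE x in m. x \<in> ?G \<longrightarrow> u' x = v' x + c"
      using u'(2) v'(2) by eventually_elim (use c in auto)
    then have "\<mu> u' u' (B \<inter> D i) = \<mu> v' v' (B \<inter> D i)"
      by (rule mu_local_up_to_constant[OF u'(1) v'(1) G' _ B'])
    then show ?thesis
      using emeasure_mu_c[OF u G' u' B'] emeasure_mu_c[OF v G' v' B'] by simp
  qed
  then show ?thesis
    using emeasure_disjoint_cover[OF sets_mu_c[OF u] D(2-4) B(1)]
      emeasure_disjoint_cover[OF sets_mu_c[OF v] D(2-4) B(1)] by simp
qed

lemma emeasure_mu_c_zero:
  assumes B: "B \<in> sets borel" shows "emeasure (mu_c m \<D> \<mu> (\<lambda>x. 0)) B = 0"
proof -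
  obtain G D :: "nat \<Rightarrow> 'a set" where G: "\<And>n. open (G n)" "\<And>n. rel_compact (G n)"
    and D: "\<And>n. D n \<subseteq> G n" "\<And>n. D n \<in> sets borel" "disjoint_family D" "(\<Union>n. D n) = UNIV"
    by (rule disjoint_rel_compact_cover) blast
  note z = D_locally_in_D[OF zero_mem]
  have "emeasure (mu_c m \<D> \<mu> (\<lambda>x. 0)) (B \<inter> D i) = 0" for i
  proof -
    have B': "B \<inter> D i \<in> sets borel" "B \<inter> D i \<subseteq> G i" using B D(1,2)[of i] by auto
    then show ?thesis
      using emeasure_mu_c[OF z G(1)[of i] G(2)[of i] zero_mem _ B']
        psd_zero[OF psd_form_mu[OF B'(1) rel_compact_subset[OF G(2)[of i] B'(2)]]] by simp
  qed
  then show ?thesis using emeasure_disjoint_cover[OF sets_mu_c[OF z] D(2-4) B] by simp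
qed

lemma formula_continuous:
  assumes "v \<in> \<D>" "continuous_on UNIV v"
  shows "ennreal (\<E> v v) = (\<integral>\<^sup>+p. ennreal ((v (fst p) - v (snd p))\<^sup>2) \<partial>J)
    + emeasure (mu_c m \<D> \<mu> v) UNIV + (\<integral>\<^sup>+x. ennreal ((v x)\<^sup>2) \<partial>k)"
  using formula[OF assms(1) qc_version_continuous[OF assms(2)]] .

lemma mu_le_energy:
  assumes v: "v \<in> \<D>" "continuous_on UNIV v" and G: "open G" "rel_compact G"
    and B: "B \<in> sets borel" "B \<subseteq> G"
  shows "\<mu> v v B \<le> \<E> v v"
proof -
  have "ennreal (\<mu> v v B) = emeasure (mu_c m \<D> \<mu> v) B"
    using emeasure_mu_c[OF D_locally_in_D[OF v(1)] G v(1) _ B] by simp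
  also have "\<dots> \<le> emeasure (mu_c m \<D> \<mu> v) UNIV"
    by (rule emeasure_mono) (simp_all add: sets_mu_c[OF D_locally_in_D[OF v(1)]])
  also have "\<dots> \<le> ennreal (\<E> v v)"
    unfolding formula_continuous[OF v]
    by (rule add_increasing2[OF zero_le add_increasing[OF zero_le order_refl]])
  finally show ?thesis using form_nonneg[OF v(1)] by (simp add: ennreal_le_iff)
qed

section \<open>Limits under an energy bound\<close>

lemma AE_eq_uniform_limit:
  assumes hD: "\<And>n. h n \<in> \<D>" and u: "u \<in> \<D>" and vm: "v \<in> borel_measurable m" and K: "compact K"
    and near: "\<And>n x. \<bar>h n x - v x\<bar> \<le> inverse (real (Suc n))"
    and off: "\<And>n x. x \<notin> K \<Longrightarrow> h n x = v x"
    and lim: "(\<lambda>n. E1 m \<E> (\<lambda>x. h n x - u x)) \<longlonglongrightarrow> 0"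
  shows "AE x in m. u x = v x"
proof -
  have um: "u \<in> borel_measurable m" and hm: "h n \<in> borel_measurable m" for n
    using u hD L2D by blast+
  have Km: "K \<in> sets m" using borel_closed[OF compact_imp_closed[OF K]] sets_m by simp
  have "emeasure m K < \<infinity>" using m_radon K by (auto simp: radon_on_def)
  then obtain b where b: "emeasure m K = ennreal b" "b \<ge> 0"
    by (cases "emeasure m K") auto
  have "(\<integral>\<^sup>+x. ennreal ((v x - u x)\<^sup>2) \<partial>m)
      \<le> ennreal (2 * ((inverse (real (Suc n)))\<^sup>2 * b + E1 m \<E> (\<lambda>x. h n x - u x)))" for n
  proof -
    define e where "e = (inverse (real (Suc n)))\<^sup>2"
    have e: "e \<ge> 0" by (simp add: e_def)
    have "ennreal ((v x - u x)\<^sup>2) \<le> 2 * (ennreal e * indicator K x + ennreal ((h n x - u x)\<^sup>2))" for x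
    proof -
      have "(v x - u x)\<^sup>2 \<le> 2 * ((v x - h n x)\<^sup>2 + (h n x - u x)\<^sup>2)"
        using sum_squares_bound[of "v x - h n x" "h n x - u x"]
        by (simp add: power2_eq_square algebra_simps)
      moreover have "(v x - h n x)\<^sup>2 \<le> e * indicator K x"
      proof (cases "x \<in> K")
        case True
        have "\<bar>v x - h n x\<bar>\<^sup>2 \<le> (inverse (real (Suc n)))\<^sup>2"
          using near[of n x] by (intro power_mono) (simp_all add: abs_minus_commute)
        then show ?thesis using True by (simp add: e_def)
      qed (simp add: off)
      ultimately have "(v x - u x)\<^sup>2 \<le> 2 * (e * indicator K x + (h n x - u x)\<^sup>2)" by argo
      then have "ennreal ((v x - u x)\<^sup>2) \<le> ennreal (2 * (e * indicator K x + (h n x - u x)\<^sup>2))"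
        by (rule ennreal_leI)
      also have "\<dots> = 2 * (ennreal e * indicator K x + ennreal ((h n x - u x)\<^sup>2))"
        using e by (cases "x \<in> K") (simp_all add: ennreal_mult)
      finally show ?thesis .
    qed
    then have "(\<integral>\<^sup>+x. ennreal ((v x - u x)\<^sup>2) \<partial>m)
      \<le> (\<integral>\<^sup>+x. 2 * (ennreal e * indicator K x + ennreal ((h n x - u x)\<^sup>2)) \<partial>m)"
      by (rule nn_integral_mono)
    also have "\<dots> = 2 * (ennreal e * emeasure m K + (\<integral>\<^sup>+x. ennreal ((h n x - u x)\<^sup>2) \<partial>m))"
      using Km um hm[of n] by (simp add: nn_integral_cmult nn_integral_add nn_integral_cmult_indicator)
    also have "(\<integral>\<^sup>+x. ennreal ((h n x - u x)\<^sup>2) \<partial>m) = ennreal (\<integral>x. (h n x - u x)\<^sup>2 \<partial>m)"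
      by (rule nn_integral_eq_integral) (simp_all add: L2D(2)[OF diff_mem[OF hD u]])
    also have "2 * (ennreal e * emeasure m K + ennreal (\<integral>x. (h n x - u x)\<^sup>2 \<partial>m))
        \<le> 2 * (ennreal e * emeasure m K + ennreal (E1 m \<E> (\<lambda>x. h n x - u x)))"
      by (intro mult_left_mono add_left_mono ennreal_leI L2_le_E1 diff_mem hD u) simp
    also have "\<dots> = ennreal (2 * (e * b + E1 m \<E> (\<lambda>x. h n x - u x)))"
      using b e E1_nonneg[OF diff_mem[OF hD u]] by (simp add: ennreal_mult)
    finally show ?thesis unfolding e_def .
  qed
  moreover have "(\<lambda>n. ennreal (2 * ((inverse (real (Suc n)))\<^sup>2 * b + E1 m \<E> (\<lambda>x. h n x - u x))))
      \<longlonglongrightarrow> ennreal (2 * (0\<^sup>2 * b + 0))"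
    by (intro tendsto_ennrealI tendsto_intros lim LIMSEQ_inverse_real_of_nat)
  ultimately have "(\<integral>\<^sup>+x. ennreal ((v x - u x)\<^sup>2) \<partial>m) \<le> ennreal (2 * (0\<^sup>2 * b + 0))"
    by (intro LIMSEQ_le_const[of _ "ennreal (2 * (0\<^sup>2 * b + 0))"]) blast+
  then have "(\<integral>\<^sup>+x. ennreal ((v x - u x)\<^sup>2) \<partial>m) = 0" by simp
  then have "AE x in m. ennreal ((v x - u x)\<^sup>2) = 0"
    using vm um by (subst (asm) nn_integral_0_iff_AE) auto
  then show ?thesis by eventually_elim simp
qed

text \<open>The functions \<open>h\<close> that satisfy all the conditions of the approximation property with error
\<open>1 / (n + 1)\<close> form a convex set \<open>C n\<close>, because \<open>\<E>\<^sub>1\<close> and \<open>\<mu>(\<cdot>,\<cdot>)(B)\<close> are convex. A Cauchy sequence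
\<open>h n \<in> C n\<close> converges in \<open>\<D>\<close>, and by uniform convergence its limit is \<open>v\<close>. The bound on \<open>\<mu>\<close> survives
because \<open>\<mu>(v - h n)(B)\<close> is at most the energy of \<open>v - h n\<close>. That last estimate comes from the energy
formula, which is available since all functions involved are continuous and thus their own
quasi-continuous versions.\<close>

lemma energy_closure:
  assumes G: "open G" "rel_compact G" and K: "compact K"
    and v: "continuous_on UNIV v" "\<And>x. x \<notin> K \<Longrightarrow> v x = 0"
    and approx: "\<And>e. e > 0 \<Longrightarrow> \<exists>h\<in>\<D>. continuous_on UNIV h \<and> (\<forall>x. x \<notin> K \<longrightarrow> h x = 0) \<and>
      (\<forall>x. \<bar>h x - v x\<bar> \<le> e) \<and> E1 m \<E> h \<le> c \<and> (\<forall>B\<in>sets borel. B \<subseteq> G \<longrightarrow> \<mu> h h B \<le> \<nu> B)"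
  shows "v \<in> \<D>" and "\<And>B. B \<in> sets borel \<Longrightarrow> B \<subseteq> G \<Longrightarrow> \<mu> v v B \<le> \<nu> B"
proof -
  define C where "C n = {h \<in> \<D>. continuous_on UNIV h \<and> (\<forall>x. x \<notin> K \<longrightarrow> h x = 0) \<and>
      (\<forall>x. \<bar>h x - v x\<bar> \<le> inverse (real (Suc n))) \<and> E1 m \<E> h \<le> c \<and>
      (\<forall>B\<in>sets borel. B \<subseteq> G \<longrightarrow> \<mu> h h B \<le> \<nu> B)}" for n
  have mid: "(\<lambda>x. (1/2) * (f x + g x)) \<in> C n" if f: "f \<in> C n" and g: "g \<in> C n" for n f g
  proof -
    have D: "f \<in> \<D>" "g \<in> \<D>" using f g by (auto simp: C_def)
    have cvx: "q (\<lambda>x. (1/2) * (f x + g x)) (\<lambda>x. (1/2) * (f x + g x)) \<le> b"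
      if "psd_form q" "q f f \<le> b" "q g g \<le> b" for q b
      using psd_midpoint[OF that(1) D] psd_nonneg[OF that(1) diff_mem[OF D]] that(2,3)
      by (simp add: field_simps)
    have "E1 m \<E> (\<lambda>x. (1/2) * (f x + g x)) \<le> c"
      using cvx[OF psd_form_E1, of c] f g by (simp only: E1_eq C_def mem_Collect_eq)
    moreover have "\<mu> (\<lambda>x. (1/2) * (f x + g x)) (\<lambda>x. (1/2) * (f x + g x)) B \<le> \<nu> B"
      if B: "B \<in> sets borel" "B \<subseteq> G" for B
      using cvx[OF psd_form_mu[OF B(1) rel_compact_subset[OF G(2) B(2)]]] f g B
      by (simp add: C_def)
    moreover have "\<bar>(1/2) * (f x + g x) - v x\<bar> \<le> inverse (real (Suc n))" for x
    proof -
      have "\<bar>f x - v x\<bar> \<le> inverse (real (Suc n))" "\<bar>g x - v x\<bar> \<le> inverse (real (Suc n))"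
        using f g by (auto simp: C_def)
      then show ?thesis by (simp only: abs_le_iff) argo
    qed
    moreover have "(\<lambda>x. (1/2) * (f x + g x)) \<in> \<D>" using D by (intro scale_mem add_mem)
    moreover have "continuous_on UNIV (\<lambda>x. (1/2) * (f x + g x))"
      using f g unfolding C_def by (auto intro!: continuous_intros)
    moreover have "\<forall>x. x \<notin> K \<longrightarrow> (1/2) * (f x + g x) = 0" using f g by (simp add: C_def)
    ultimately show ?thesis unfolding C_def by blast
  qed
  have ne: "C n \<noteq> {}" for n
    using approx[of "inverse (real (Suc n))"] by (auto simp: C_def)
  have dec: "decseq C"
    unfolding decseq_def
  proof (intro allI impI subsetI)
    fix i j f assume ij: "i \<le> j" and f: "f \<in> C j"
    have "inverse (real (Suc j)) \<le> inverse (real (Suc i))"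
      using ij by (intro le_imp_inverse_le) auto
    moreover have "\<bar>f x - v x\<bar> \<le> inverse (real (Suc j))" for x using f by (simp add: C_def)
    ultimately have "\<bar>f x - v x\<bar> \<le> inverse (real (Suc i))" for x using order_trans by blast
    then show "f \<in> C i" using f by (simp add: C_def)
  qed
  have sub: "C n \<subseteq> \<D>" and bound: "\<And>f. f \<in> C n \<Longrightarrow> E1 m \<E> f \<le> c" for n
    by (auto simp: C_def)
  have "\<exists>h u. (\<forall>n. h n \<in> C n) \<and> u \<in> \<D> \<and> (\<lambda>n. E1 m \<E> (\<lambda>x. h n x - u x)) \<longlonglongrightarrow> 0"
    by (rule decreasing_convex_limit[of C c], rule sub, rule ne, rule dec, erule (1) mid, erule bound)
      blast
  then obtain h u where h: "\<And>n. h n \<in> C n" and u: "u \<in> \<D>"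
    and lim: "(\<lambda>n. E1 m \<E> (\<lambda>x. h n x - u x)) \<longlonglongrightarrow> 0" by blast
  have hD: "h n \<in> \<D>" and hc: "continuous_on UNIV (h n)" for n using h[of n] by (auto simp: C_def)
  have vm: "v \<in> borel_measurable m"
    unfolding measurable_m using v(1) by (rule borel_measurable_continuous_onI)
  have ae: "AE x in m. u x = v x"
    by (rule AE_eq_uniform_limit[OF hD u vm K _ _ lim])
      (use h v(2) in \<open>simp_all add: C_def\<close>)
  show vD: "v \<in> \<D>" by (rule class_mem[OF u vm ae])
  have en: "\<E> (\<lambda>x. v x - h n x) (\<lambda>x. v x - h n x) \<le> E1 m \<E> (\<lambda>x. h n x - u x)" for n
  proof -
    let ?f = "\<lambda>x. h n x - u x" and ?g = "\<lambda>x. h n x - v x"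
    have D: "?f \<in> \<D>" "?g \<in> \<D>" using hD u vD by (auto intro: diff_mem)
    have ae': "AE x in m. ?f x = ?g x" using ae by eventually_elim simp
    have "\<E> (\<lambda>x. v x - h n x) (\<lambda>x. v x - h n x) = \<E> ?g ?g"
      using psd_scale[OF psd_form_E D(2), of "-1"] by simp
    also have "\<dots> = \<E> ?f ?f"
      using class_form[OF D D(1) ae'] class_form[OF D D(2) ae'] form_sym[OF D] by simp
    finally show ?thesis using energy_le_E1[of ?f] by simp
  qed
  fix B assume B: "B \<in> sets borel" "B \<subseteq> G"
  note q = psd_form_mu[OF B(1) rel_compact_subset[OF G(2) B(2)]]
  have \<nu>: "\<mu> (h n) (h n) B \<le> \<nu> B" for n using h[of n] B by (auto simp: C_def)
  \<comment> \<open>Split \<open>v\<close> into \<open>h n\<close> and the small remainder \<open>v - h n\<close>; the factor \<open>1 + t\<close> is removed at the end.\<close>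
  have le: "\<mu> v v B \<le> (1 + t) * \<nu> B" if t: "t > 0" for t
  proof -
    have "\<mu> v v B \<le> (1 + t) * \<nu> B + (1 + 1/t) * E1 m \<E> (\<lambda>x. h n x - u x)" for n
    proof -
      have d: "(\<lambda>x. v x - h n x) \<in> \<D>" using vD hD by (rule diff_mem)
      have "\<mu> v v B \<le> (1 + t) * \<mu> (h n) (h n) B + (1 + 1/t) * \<mu> (\<lambda>x. v x - h n x) (\<lambda>x. v x - h n x) B"
        using psd_add_le[OF q hD[of n] d t] by simp
      also have "\<dots> \<le> (1 + t) * \<nu> B + (1 + 1/t) * E1 m \<E> (\<lambda>x. h n x - u x)"
      proof (intro add_mono mult_left_mono \<nu>)
        have "\<mu> (\<lambda>x. v x - h n x) (\<lambda>x. v x - h n x) B \<le> \<E> (\<lambda>x. v x - h n x) (\<lambda>x. v x - h n x)"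
          by (rule mu_le_energy[OF d _ G B]) (intro continuous_intros v(1) hc)
        then show "\<mu> (\<lambda>x. v x - h n x) (\<lambda>x. v x - h n x) B \<le> E1 m \<E> (\<lambda>x. h n x - u x)"
          using en[of n] by linarith
      qed (use t in auto)
      finally show ?thesis .
    qed
    moreover have "(\<lambda>n. (1 + t) * \<nu> B + (1 + 1/t) * E1 m \<E> (\<lambda>x. h n x - u x))
        \<longlonglongrightarrow> (1 + t) * \<nu> B + (1 + 1/t) * 0"
      by (intro tendsto_intros lim)
    ultimately have "\<mu> v v B \<le> (1 + t) * \<nu> B + (1 + 1/t) * 0"
      by (intro LIMSEQ_le_const) auto
    then show ?thesis by simp
  qed
  have "(\<lambda>n. (1 + inverse (real (Suc n))) * \<nu> B) \<longlonglongrightarrow> (1 + 0) * \<nu> B"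
    by (intro tendsto_intros LIMSEQ_inverse_real_of_nat)
  moreover have "\<mu> v v B \<le> (1 + inverse (real (Suc n))) * \<nu> B" for n by (rule le) simp
  ultimately have "\<mu> v v B \<le> (1 + 0) * \<nu> B" by (intro LIMSEQ_le_const) auto
  then show "\<mu> v v B \<le> \<nu> B" by simp
qed

end

section \<open>Truncation by a compactly supported function\<close>

context lc_beurling_deny
begin

lemma locally_in_D_sum:
  assumes I: "finite I" and f: "\<And>i. i \<in> I \<Longrightarrow> locally_in_D (f i)"
  shows "locally_in_D (\<lambda>x. \<Sum>i\<in>I. f i x)"
  unfolding locally_in_D_def
proof (intro allI impI)
  fix G :: "'a set" assume G: "open G" "rel_compact G"
  have "\<forall>i\<in>I. \<exists>v. v \<in> \<D> \<and> (AE x in m. x \<in> G \<longrightarrow> f i x = v x)"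
    using f G unfolding locally_in_D_def by blast
  from bchoice[OF this] obtain v
    where v: "\<forall>i\<in>I. v i \<in> \<D> \<and> (AE x in m. x \<in> G \<longrightarrow> f i x = v i x)" ..
  show "\<exists>w\<in>\<D>. AE x in m. x \<in> G \<longrightarrow> (\<Sum>i\<in>I. f i x) = w x"
  proof (rule bexI[of _ "\<lambda>x. \<Sum>i\<in>I. v i x"])
    have "AE x in m. \<forall>i\<in>I. x \<in> G \<longrightarrow> f i x = v i x"
      by (rule AE_finite_allI[OF I]) (use v in blast)
    then show "AE x in m. x \<in> G \<longrightarrow> (\<Sum>i\<in>I. f i x) = (\<Sum>i\<in>I. v i x)"
      by eventually_elim (auto intro: sum.cong)
    show "(\<lambda>x. \<Sum>i\<in>I. v i x) \<in> \<D>" using v I by (intro sum_mem) auto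
  qed
qed

context
  fixes w \<psi> :: "'a \<Rightarrow> real" and K
  assumes w: "locally_in_D w" "continuous_on UNIV w" "\<And>x. w x \<ge> 0"
    and \<psi>: "\<psi> \<in> \<D>" "\<psi> \<in> Cc" "\<And>x. \<psi> x \<ge> 0"
    and K_def: "K = closure {x. \<psi> x \<noteq> 0}"
begin

lemma truncation_support: "compact K" "x \<notin> K \<Longrightarrow> \<psi> x = 0"
proof -
  show "compact K" using \<psi>(2) by (simp add: Cc_def K_def)
  show "\<psi> x = 0" if "x \<notin> K" using that subsetD[OF closure_subset, of x "{x. \<psi> x \<noteq> 0}"] by (auto simp: K_def)
qed

lemma psi_continuous: "continuous_on UNIV \<psi>"
  using \<psi>(2) by (simp add: Cc_def)

lemma truncation_continuous: "continuous_on UNIV (\<lambda>x. min (w x) (\<psi> x))"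
  by (intro continuous_intros w(2) psi_continuous)

text \<open>Off the support \<open>K\<close> of \<open>\<psi>\<close> the minimum is \<open>0\<close>; near \<open>K\<close> the function \<open>w\<close> may be replaced by an
element of \<open>\<D>\<close>, whose positive part is taken so that nothing remains off \<open>K\<close>.\<close>

lemma truncation_mem: "(\<lambda>x. min (w x) (\<psi> x)) \<in> \<D>"
proof -
  obtain G where G: "open G" "rel_compact G" "K \<subseteq> G"
    by (rule compact_subset_open_rel_compact[OF loc_compact truncation_support(1)]) blast
  obtain w' where w': "w' \<in> \<D>" "AE x in m. x \<in> G \<longrightarrow> w x = w' x"
    using w(1) G(1,2) unfolding locally_in_D_def by blast
  have mem: "(\<lambda>x. min (max 0 (w' x)) (\<psi> x)) \<in> \<D>"
    by (intro min_mem pos_part_mem w' \<psi>)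
  show ?thesis
  proof (rule class_mem[OF mem])
    show "(\<lambda>x. min (w x) (\<psi> x)) \<in> borel_measurable m"
      unfolding measurable_m by (rule borel_measurable_continuous_onI[OF truncation_continuous])
    show "AE x in m. min (max 0 (w' x)) (\<psi> x) = min (w x) (\<psi> x)"
      using w'(2)
    proof eventually_elim
      case (elim x)
      show ?case
      proof (cases "x \<in> K")
        case True
        then show ?thesis using elim G(3) w(3)[of x] by auto
      next
        case False
        then show ?thesis using truncation_support(2)[OF False] w(3)[of x] by auto
      qed
    qed
  qed
qed

text \<open>Write the minimum as \<open>v = \<psi> - p\<close> with \<open>p = (\<psi> - w)\<^sup>+\<close>, and let \<open>r\<close> stand for \<open>(w - \<psi>)\<^sup>+\<close>. By strong
locality the positive and negative part of \<open>\<psi> - w\<close> are orthogonal: \<open>p\<close> is supported in the closed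
set \<open>{w \<le> \<psi>} \<inter> K\<close>, where \<open>r = 0\<close>. Hence \<open>\<mu>(p) \<le> \<mu>(p) + \<mu>(r) = \<mu>(\<psi> - w)\<close> on \<open>K\<close>, and the constants arise
from \<open>\<mu>(a - b) \<le> 2 \<mu>(a) + 2 \<mu>(b)\<close> applied twice.\<close>

lemma mu_c_truncation_le:
  "emeasure (mu_c m \<D> \<mu> (\<lambda>x. min (w x) (\<psi> x))) UNIV
    \<le> 6 * ennreal (\<mu> \<psi> \<psi> K) + 4 * emeasure (mu_c m \<D> \<mu> w) K"
proof -
  define v where "v = (\<lambda>x. min (w x) (\<psi> x))"
  define p where "p = (\<lambda>x. \<psi> x - v x)"
  have v: "v \<in> \<D>" unfolding v_def by (rule truncation_mem)
  have p: "p \<in> \<D>" unfolding p_def by (rule diff_mem[OF \<psi>(1) v])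
  have cK: "closed K" using compact_imp_closed[OF truncation_support(1)] .
  have KB: "K \<in> sets borel" "- K \<in> sets borel" using cK by auto
  have rK: "rel_compact K" by (rule compact_imp_rel_compact[OF truncation_support(1)])
  note q = psd_form_mu[OF KB(1) rK]
  obtain G where G: "open G" "rel_compact G" "K \<subseteq> G"
    by (rule compact_subset_open_rel_compact[OF loc_compact truncation_support(1)]) blast
  obtain w' where w': "w' \<in> \<D>" "AE x in m. x \<in> G \<longrightarrow> w x = w' x"
    using w(1) G(1,2) unfolding locally_in_D_def by blast
  define r where "r = (\<lambda>x. max 0 (w' x - \<psi> x))"
  have r: "r \<in> \<D>" unfolding r_def by (intro pos_part_mem diff_mem w' \<psi>)
  have d: "(\<lambda>x. \<psi> x - w' x) \<in> \<D>" by (intro diff_mem w' \<psi>)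
  have pc: "continuous_on UNIV p"
    unfolding p_def v_def by (intro continuous_intros w(2) psi_continuous)
  have supp_p: "ae_support m p \<subseteq> {x. w x \<le> \<psi> x} \<inter> K"
  proof -
    have "closed {x. w x \<le> \<psi> x}" by (intro closed_Collect_le w(2) psi_continuous)
    then have "closed ({x. w x \<le> \<psi> x} \<inter> K)" using cK by (rule closed_Int)
    moreover have "{x. p x \<noteq> 0} \<subseteq> {x. w x \<le> \<psi> x} \<inter> K"
    proof
      fix x assume x: "x \<in> {x. p x \<noteq> 0}"
      then have "w x < \<psi> x" by (auto simp: p_def v_def min_def split: if_splits)
      moreover have "x \<in> K"
        using truncation_support(2)[of x] w(3)[of x] \<open>w x < \<psi> x\<close> by force
      ultimately show "x \<in> {x. w x \<le> \<psi> x} \<inter> K" by simp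
    qed
    ultimately have "closure {x. p x \<noteq> 0} \<subseteq> {x. w x \<le> \<psi> x} \<inter> K" by (intro closure_minimal)
    then show ?thesis using ae_support_subset[of m p] by (rule order_trans[rotated])
  qed
  have "\<mu> r p K = 0"
  proof (rule strongly_local[OF r p _ KB(1) rK, where c = 0])
    show "AE x in m. x \<in> ae_support m p \<longrightarrow> r x = 0"
      using w'(2)
    proof eventually_elim
      case (elim x)
      show ?case
      proof
        assume "x \<in> ae_support m p"
        then have "w x \<le> \<psi> x" "x \<in> G" using supp_p G(3) by auto
        then show "r x = 0" using elim by (simp add: r_def)
      qed
    qed
  qed
  then have "\<mu> (\<lambda>x. p x - r x) (\<lambda>x. p x - r x) K = \<mu> p p K + \<mu> r r K"
    using psd_diff[OF q p r] psd_sym[OF q p r] by simp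
  moreover have "\<mu> (\<lambda>x. p x - r x) (\<lambda>x. p x - r x) K = \<mu> (\<lambda>x. \<psi> x - w' x) (\<lambda>x. \<psi> x - w' x) K"
  proof (rule local[OF diff_mem[OF p r] d G(1,2) _ KB(1) G(3)])
    show "AE x in m. x \<in> G \<longrightarrow> p x - r x = \<psi> x - w' x"
      using w'(2) by eventually_elim (auto simp: p_def r_def v_def)
  qed
  ultimately have "\<mu> p p K \<le> \<mu> (\<lambda>x. \<psi> x - w' x) (\<lambda>x. \<psi> x - w' x) K"
    using psd_nonneg[OF q r] by simp
  also have "\<dots> \<le> 2 * \<mu> \<psi> \<psi> K + 2 * \<mu> w' w' K" by (rule psd_diff_le[OF q \<psi>(1) w'(1)])
  finally have pp: "\<mu> p p K \<le> 2 * \<mu> \<psi> \<psi> K + 2 * \<mu> w' w' K" .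
  have "v = (\<lambda>x. \<psi> x - p x)" by (simp add: p_def)
  then have "\<mu> v v K \<le> 2 * \<mu> \<psi> \<psi> K + 2 * \<mu> p p K"
    using psd_diff_le[OF q \<psi>(1) p] by simp
  with pp have vv: "\<mu> v v K \<le> 6 * \<mu> \<psi> \<psi> K + 4 * \<mu> w' w' K" by argo
  note lv = D_locally_in_D[OF v]
  have "emeasure (mu_c m \<D> \<mu> v) UNIV = emeasure (mu_c m \<D> \<mu> v) K + emeasure (mu_c m \<D> \<mu> v) (- K)"
    using plus_emeasure[of K "mu_c m \<D> \<mu> v" "- K"] KB sets_mu_c[OF lv] by simp
  also have "emeasure (mu_c m \<D> \<mu> v) (- K) = emeasure (mu_c m \<D> \<mu> (\<lambda>x. 0)) (- K)"
  proof (rule emeasure_mu_c_up_to_constant[OF lv D_locally_in_D[OF zero_mem], where H = "- K" and c = 0])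
    show "v x = 0 + 0" if "x \<in> - K" for x
      using truncation_support(2)[of x] that w(3)[of x] by (simp add: v_def)
  qed (use cK KB in auto)
  also have "\<dots> = 0" by (rule emeasure_mu_c_zero[OF KB(2)])
  also have "emeasure (mu_c m \<D> \<mu> v) K = ennreal (\<mu> v v K)"
    by (rule emeasure_mu_c[OF lv G(1,2) v _ KB(1) G(3)]) simp
  also have "ennreal (\<mu> v v K) + 0 \<le> ennreal (6 * \<mu> \<psi> \<psi> K + 4 * \<mu> w' w' K)"
    using vv by (simp add: ennreal_leI)
  also have "\<dots> = 6 * ennreal (\<mu> \<psi> \<psi> K) + 4 * ennreal (\<mu> w' w' K)"
    using psd_nonneg[OF q \<psi>(1)] psd_nonneg[OF q w'(1)] by (simp add: ennreal_mult)
  also have "ennreal (\<mu> w' w' K) = emeasure (mu_c m \<D> \<mu> w) K"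
    by (rule emeasure_mu_c[OF w(1) G(1,2) w' KB(1) G(3), symmetric])
  finally show ?thesis unfolding v_def .
qed

text \<open>Only \<open>\<psi>\<close> has finite energy, while \<open>w\<close> is controlled on the support \<open>K\<close> of \<open>\<psi>\<close>. For the jump part,
if both points of a pair are in \<open>K\<close>, the increment of the minimum is at most the larger of the two
increments. Otherwise one of the values of the minimum is \<open>0\<close>, and the increment of \<open>\<psi>\<close> alone
dominates, so that \<open>w\<close> enters only through pairs whose first point is in \<open>K\<close>.\<close>

lemma energy_truncation_le:
  "ennreal (\<E> (\<lambda>x. min (w x) (\<psi> x)) (\<lambda>x. min (w x) (\<psi> x)))
    \<le> ennreal (\<E> \<psi> \<psi>) + mu_b m \<D> \<E> J w K + (6 * ennreal (\<mu> \<psi> \<psi> K) + 4 * emeasure (mu_c m \<D> \<mu> w) K)"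
proof -
  let ?v = "\<lambda>x. min (w x) (\<psi> x)"
  define j where "j f p = ennreal ((f (fst p) - f (snd p))\<^sup>2)" for f :: "'a \<Rightarrow> real" and p :: "'a \<times> 'a"
  have mj: "j f \<in> borel_measurable J" if "continuous_on UNIV f" for f
    unfolding j_def by (rule jump_measurable[OF borel_measurable_continuous_onI[OF that]])
  have "K \<in> sets borel" using compact_imp_closed[OF truncation_support(1)] by auto
  then have mK: "(\<lambda>p. indicator K (fst p) :: ennreal) \<in> borel_measurable J"
    by (intro measurable_fst_J) simp
  have pt: "j ?v p \<le> j \<psi> p + j w p * indicator K (fst p)" for p
  proof (cases "fst p \<in> K \<and> snd p \<in> K")
    case True
    have "(min a c - min b d)\<^sup>2 \<le> (c - d)\<^sup>2 + (a - b)\<^sup>2" for a b c d :: real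
    proof -
      have "\<bar>min a c - min b d\<bar> \<le> max \<bar>c - d\<bar> \<bar>a - b\<bar>" by (auto simp: min_def max_def)
      then have "\<bar>min a c - min b d\<bar>\<^sup>2 \<le> (max \<bar>c - d\<bar> \<bar>a - b\<bar>)\<^sup>2" by (rule power_mono) simp
      also have "\<dots> \<le> (c - d)\<^sup>2 + (a - b)\<^sup>2" by (simp add: max_def)
      finally show ?thesis by simp
    qed
    then show ?thesis using True unfolding j_def by (simp add: ennreal_plus[symmetric] del: ennreal_plus)
  next
    case False
    have "\<bar>?v (fst p) - ?v (snd p)\<bar> \<le> \<bar>\<psi> (fst p) - \<psi> (snd p)\<bar>"
      using False truncation_support(2)[of "fst p"] truncation_support(2)[of "snd p"]
        w(3)[of "fst p"] w(3)[of "snd p"] \<psi>(3)[of "fst p"] \<psi>(3)[of "snd p"] by auto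
    then have "\<bar>?v (fst p) - ?v (snd p)\<bar>\<^sup>2 \<le> \<bar>\<psi> (fst p) - \<psi> (snd p)\<bar>\<^sup>2" by (rule power_mono) simp
    then have "j ?v p \<le> j \<psi> p" unfolding j_def by (intro ennreal_leI) simp
    then show ?thesis by (rule add_increasing2[OF zero_le])
  qed
  have "(\<integral>\<^sup>+p. j ?v p \<partial>J) \<le> (\<integral>\<^sup>+p. j \<psi> p + j w p * indicator K (fst p) \<partial>J)"
    using pt by (intro nn_integral_mono)
  also have "\<dots> = (\<integral>\<^sup>+p. j \<psi> p \<partial>J) + (\<integral>\<^sup>+p. j w p * indicator K (fst p) \<partial>J)"
    by (intro nn_integral_add borel_measurable_times_ennreal mj mK w(2) psi_continuous)
  also have "(\<integral>\<^sup>+p. j w p * indicator K (fst p) \<partial>J) = mu_b m \<D> \<E> J w K"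
    unfolding mu_b_continuous[OF w(2)] j_def ..
  finally have jump: "(\<integral>\<^sup>+p. j ?v p \<partial>J) \<le> (\<integral>\<^sup>+p. j \<psi> p \<partial>J) + mu_b m \<D> \<E> J w K" .
  have kill: "(\<integral>\<^sup>+x. ennreal ((?v x)\<^sup>2) \<partial>k) \<le> (\<integral>\<^sup>+x. ennreal ((\<psi> x)\<^sup>2) \<partial>k)"
    using w(3) \<psi>(3) by (intro nn_integral_mono ennreal_leI power_mono) auto
  have "ennreal (\<E> ?v ?v) = (\<integral>\<^sup>+p. j ?v p \<partial>J) + emeasure (mu_c m \<D> \<mu> ?v) UNIV
      + (\<integral>\<^sup>+x. ennreal ((?v x)\<^sup>2) \<partial>k)"
    unfolding j_def by (rule formula_continuous[OF truncation_mem truncation_continuous])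
  also have "\<dots> \<le> ((\<integral>\<^sup>+p. j \<psi> p \<partial>J) + mu_b m \<D> \<E> J w K)
      + (6 * ennreal (\<mu> \<psi> \<psi> K) + 4 * emeasure (mu_c m \<D> \<mu> w) K) + (\<integral>\<^sup>+x. ennreal ((\<psi> x)\<^sup>2) \<partial>k)"
    by (intro add_mono jump mu_c_truncation_le kill)
  also have "\<dots> = ((\<integral>\<^sup>+p. j \<psi> p \<partial>J) + (\<integral>\<^sup>+x. ennreal ((\<psi> x)\<^sup>2) \<partial>k)) + mu_b m \<D> \<E> J w K
      + (6 * ennreal (\<mu> \<psi> \<psi> K) + 4 * emeasure (mu_c m \<D> \<mu> w) K)"
    by (simp only: add_ac)
  also have "(\<integral>\<^sup>+p. j \<psi> p \<partial>J) + (\<integral>\<^sup>+x. ennreal ((\<psi> x)\<^sup>2) \<partial>k) \<le> ennreal (\<E> \<psi> \<psi>)"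
    unfolding formula_continuous[OF \<psi>(1) psi_continuous] j_def
    by (intro add_right_mono add_increasing2 zero_le order_refl)
  finally show ?thesis by (simp add: add_right_mono)
qed

end

end

section \<open>Truncated distance functions and Lipschitz functions\<close>

lemma dist_trunc_bounds: "0 \<le> dist_trunc \<rho> A T x" "T \<ge> 0 \<Longrightarrow> dist_trunc \<rho> A T x \<le> T"
  by (auto simp: dist_trunc_def intro: enn2real_leI)

lemma ennreal_dist_trunc: "ennreal (dist_trunc \<rho> A T x) = min (INF y\<in>A. \<rho> x y) (ennreal T)"
  unfolding dist_trunc_def by (rule ennreal_enn2real) (simp add: min_less_iff_disj)

lemma dist_trunc_le:
  assumes "a \<in> A" "\<rho> x a \<le> ennreal r" "r \<ge> 0" shows "dist_trunc \<rho> A T x \<le> r"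
proof -
  have "ennreal (dist_trunc \<rho> A T x) \<le> ennreal r"
    unfolding ennreal_dist_trunc
    by (intro min.coboundedI1 order_trans[OF INF_lower[OF assms(1), of "\<rho> x"] assms(2)])
  then show ?thesis using assms(3) by (simp add: ennreal_le_iff)
qed

lemma dist_trunc_ge:
  assumes "\<And>a. a \<in> A \<Longrightarrow> ennreal s \<le> \<rho> x a" "s \<le> T"
  shows "s \<le> dist_trunc \<rho> A T x"
proof -
  have "ennreal s \<le> ennreal (dist_trunc \<rho> A T x)"
    unfolding ennreal_dist_trunc using assms by (intro min.boundedI INF_greatest ennreal_leI)
  then show ?thesis using dist_trunc_bounds(1)[of \<rho> A T x] by (cases "s \<ge> 0") (auto simp: ennreal_le_iff)
qed

lemma dist_trunc_shift:
  assumes tri: "\<And>a. \<rho> x a \<le> \<rho> x y + \<rho> y a" and r: "\<rho> x y \<le> ennreal r" "r \<ge> 0"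
  shows "dist_trunc \<rho> A T x \<le> dist_trunc \<rho> A T y + r"
proof -
  have "(INF a\<in>A. \<rho> x a) - ennreal r \<le> (INF a\<in>A. \<rho> y a)"
  proof (rule INF_greatest)
    fix a assume a: "a \<in> A"
    have "(INF a\<in>A. \<rho> x a) \<le> \<rho> x y + \<rho> y a" using INF_lower[OF a, of "\<rho> x"] tri by (rule order_trans)
    also have "\<dots> \<le> ennreal r + \<rho> y a" using r(1) by (rule add_right_mono)
    finally show "(INF a\<in>A. \<rho> x a) - ennreal r \<le> \<rho> y a" by (simp add: ennreal_minus_le_iff)
  qed
  then have "(INF a\<in>A. \<rho> x a) \<le> (INF a\<in>A. \<rho> y a) + ennreal r"
    by (simp add: ennreal_minus_le_iff add.commute)
  then have "min (INF a\<in>A. \<rho> x a) (ennreal T) \<le> min (INF a\<in>A. \<rho> y a) (ennreal T) + ennreal r"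
    by (cases "(INF a\<in>A. \<rho> y a) \<le> ennreal T")
      (simp_all add: min.coboundedI1 min.coboundedI2 min.absorb1 min.absorb2)
  then have "ennreal (dist_trunc \<rho> A T x) \<le> ennreal (dist_trunc \<rho> A T y + r)"
    using r(2) dist_trunc_bounds(1)[of \<rho> A T y] by (simp add: ennreal_dist_trunc[symmetric])
  then show ?thesis
    using r(2) dist_trunc_bounds(1)[of \<rho> A T y] by (subst (asm) ennreal_le_iff) auto
qed

locale intrinsic_metric_space = lc_beurling_deny m \<D> \<E> J \<mu> k
  for m :: "'a::{metric_space,second_countable_topology} measure"
    and \<D> :: "('a \<Rightarrow> real) set"
    and \<E> :: "('a \<Rightarrow> real) \<Rightarrow> ('a \<Rightarrow> real) \<Rightarrow> real"
    and J :: "('a \<times> 'a) measure"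
    and \<mu> :: "('a \<Rightarrow> real) \<Rightarrow> ('a \<Rightarrow> real) \<Rightarrow> 'a set \<Rightarrow> real"
    and k :: "'a measure" +
  fixes \<rho> :: "'a \<Rightarrow> 'a \<Rightarrow> ennreal" and m\<^sub>b m\<^sub>c :: "'a measure"
  assumes pseudo: "pseudo_metric \<rho>"
    and mb_radon: "radon_measure m\<^sub>b" and mc_radon: "radon_measure m\<^sub>c"
    and dist_locally_in_D: "\<And>A T. T > 0 \<Longrightarrow> locally_in_D (dist_trunc \<rho> A T)"
    and dist_continuous: "\<And>A T. T > 0 \<Longrightarrow> continuous_on UNIV (dist_trunc \<rho> A T)"
    and dist_mu_b: "\<And>A T B. T > 0 \<Longrightarrow> B \<in> sets borel \<Longrightarrow>
      mu_b m \<D> \<E> J (dist_trunc \<rho> A T) B \<le> emeasure m\<^sub>b B"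
    and dist_mu_c: "\<And>A T B. T > 0 \<Longrightarrow> B \<in> sets borel \<Longrightarrow>
      emeasure (mu_c m \<D> \<mu> (dist_trunc \<rho> A T)) B \<le> emeasure m\<^sub>c B"
begin

lemma rho_refl: "\<rho> x x = 0" and rho_sym: "\<rho> x y = \<rho> y x"
  and rho_triangle: "\<rho> x z \<le> \<rho> x y + \<rho> y z"
  using pseudo by (simp_all add: pseudo_metric_def)

lemma sets_mb: "sets m\<^sub>b = sets borel" and sets_mc: "sets m\<^sub>c = sets borel"
  using mb_radon mc_radon by (auto simp: radon_on_def)

definition lipschitz :: "('a \<Rightarrow> real) \<Rightarrow> bool" where
  "lipschitz u \<longleftrightarrow> (\<forall>x y. ennreal \<bar>u x - u y\<bar> \<le> \<rho> x y)"

lemma lipschitzD: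
  assumes "lipschitz u" "\<rho> x y \<le> ennreal r" "r \<ge> 0" shows "\<bar>u x - u y\<bar> \<le> r"
proof -
  have "ennreal \<bar>u x - u y\<bar> \<le> \<rho> x y" using assms(1) by (simp add: lipschitz_def)
  then have "ennreal \<bar>u x - u y\<bar> \<le> ennreal r" using assms(2) by (rule order_trans)
  then show ?thesis using assms(3) by (simp add: ennreal_le_iff)
qed

lemma lipschitzI:
  assumes "\<And>x y r. \<rho> x y = ennreal r \<Longrightarrow> r \<ge> 0 \<Longrightarrow> \<bar>u x - u y\<bar> \<le> r"
  shows "lipschitz u"
  unfolding lipschitz_def
proof (intro allI)
  fix x y show "ennreal \<bar>u x - u y\<bar> \<le> \<rho> x y"
    using assms[of x y] by (cases "\<rho> x y") (auto intro: ennreal_leI)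
qed

lemma lipschitz_contraction:
  assumes "lipschitz u" "\<And>s t. \<bar>F s - F t\<bar> \<le> \<bar>s - t\<bar>"
  shows "lipschitz (\<lambda>x. F (u x))"
proof (rule lipschitzI)
  fix x y r assume "\<rho> x y = ennreal r" "r \<ge> 0"
  then have "\<bar>u x - u y\<bar> \<le> r" by (intro lipschitzD[OF assms(1)]) simp_all
  with assms(2) show "\<bar>F (u x) - F (u y)\<bar> \<le> r" by (rule order_trans)
qed

text \<open>Defined through \<open>\<rho> \<and> 1\<close>, as only truncated distances are known to be continuous. For radii up to
\<open>1\<close> the truncation is invisible.\<close>

definition rho_ball :: "'a \<Rightarrow> real \<Rightarrow> 'a set" where
  "rho_ball x e = {y. dist_trunc \<rho> {x} 1 y < e}"

lemma open_rho_ball: "open (rho_ball x e)"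
  unfolding rho_ball_def by (intro open_Collect_less dist_continuous continuous_on_const) simp

lemma centre_rho_ball: assumes "e > 0" shows "x \<in> rho_ball x e"
  using dist_trunc_le[of x "{x}" \<rho> x 0 1] rho_refl assms by (simp add: rho_ball_def)

lemma rho_ball_less:
  assumes y: "y \<in> rho_ball x e" and e: "0 < e" "e \<le> 1" shows "\<rho> y x \<le> ennreal e"
proof -
  have "ennreal (dist_trunc \<rho> {x} 1 y) < ennreal e"
    using y e by (simp add: rho_ball_def ennreal_lessI)
  then have "min (\<rho> y x) (ennreal 1) < ennreal e" by (simp only: ennreal_dist_trunc) simp
  then show ?thesis using e by (auto simp: min_less_iff_disj ennreal_less_iff)
qed

lemma lipschitz_continuous:
  assumes u: "lipschitz u" shows "continuous_on UNIV u"
  unfolding continuous_on_def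
proof (intro ballI tendstoI)
  fix x and e :: real assume e: "e > 0"
  define d where "d = min (e / 2) 1"
  have d: "0 < d" "d \<le> 1" "d < e" using e by (auto simp: d_def)
  have "eventually (\<lambda>y. y \<in> rho_ball x d) (nhds x)"
    using open_rho_ball centre_rho_ball[OF d(1)] by (rule eventually_nhds_in_open)
  then have "eventually (\<lambda>y. y \<in> rho_ball x d) (at x within UNIV)"
    by (simp add: eventually_at_filter eventually_mono)
  then show "eventually (\<lambda>y. dist (u y) (u x) < e) (at x within UNIV)"
  proof eventually_elim
    case (elim y)
    then show ?case
      using lipschitzD[OF u rho_ball_less[OF elim d(1,2)]] d by (simp add: dist_real_def)
  qed
qed

text \<open>Let \<open>A\<close> be part of a ball \<open>O\<close> of radius \<open>e\<close> and \<open>x \<in> A\<close>. All points of \<open>O\<close> have distance at most \<open>2 e\<close>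
from \<open>x\<close>, so \<open>\<bar>u x - u y\<bar> - 2 e\<close> is at most the distance \<open>\<rho>\<^sub>O y\<close>, while \<open>\<rho>\<^sub>O x = 0\<close>. Thus the integral over
pairs starting in \<open>A\<close> is bounded by \<open>\<mu>\<^sup>b(\<rho>\<^sub>O \<and> T)(A) \<le> m\<^sub>b(A)\<close>. Countably many balls cover \<open>X\<close>, and the
integral is a measure in \<open>A\<close>.\<close>

lemma truncated_jump_le:
  assumes u: "lipschitz u" and e: "0 < e" "e \<le> 1" and T: "T > 0" and B: "B \<in> sets borel"
  shows "(\<integral>\<^sup>+p. ennreal ((max 0 (min \<bar>u (fst p) - u (snd p)\<bar> T - 2 * e))\<^sup>2) * indicator B (fst p) \<partial>J)
    \<le> emeasure m\<^sub>b B"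
proof -
  define g where "g p = ennreal ((max 0 (min \<bar>u (fst p) - u (snd p)\<bar> T - 2 * e))\<^sup>2)" for p
  have um: "u \<in> borel_measurable borel"
    by (rule borel_measurable_continuous_onI[OF lipschitz_continuous[OF u]])
  have gm: "g \<in> borel_measurable J"
    unfolding g_def using measurable_fst_J[OF um] measurable_snd_J[OF um] by measurable
  have fm: "fst \<in> measurable J borel" using measurable_fst_J[of "\<lambda>x. x"] by simp
  \<comment> \<open>The integral over pairs with first point in a given set, as a measure on \<open>X\<close>.\<close>
  define N where "N = distr (density J g) borel fst"
  have N: "emeasure N A = (\<integral>\<^sup>+p. g p * indicator A (fst p) \<partial>J)" if A: "A \<in> sets borel" for A
  proof -
    have "emeasure N A = emeasure (density J g) (fst -` A \<inter> space J)"
      unfolding N_def using fm A by (subst emeasure_distr) auto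
    also have "\<dots> = (\<integral>\<^sup>+p. g p * indicator (fst -` A \<inter> space J) p \<partial>J)"
      using gm measurable_sets[OF fm A] by (rule emeasure_density)
    also have "\<dots> = (\<integral>\<^sup>+p. g p * indicator A (fst p) \<partial>J)"
      by (intro nn_integral_cong) (simp add: indicator_def)
    finally show ?thesis .
  qed
  have small: "emeasure N A \<le> emeasure m\<^sub>b A" if A: "A \<in> sets borel" "A \<subseteq> rho_ball z e" for A z
  proof -
    let ?O = "rho_ball z e"
    let ?d = "dist_trunc \<rho> ?O T"
    have "g p * indicator A (fst p) \<le> ennreal ((?d (fst p) - ?d (snd p))\<^sup>2) * indicator A (fst p)" for p
    proof (cases "fst p \<in> A")
      case True
      define x y where "x = fst p" and "y = snd p"
      have x: "x \<in> ?O" using True A(2) by (auto simp: x_def)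
      have dx: "?d x = 0"
        using dist_trunc_le[of x ?O \<rho> x 0 T] x rho_refl dist_trunc_bounds(1)[of \<rho> ?O T x] by simp
      have "min \<bar>u x - u y\<bar> T - 2 * e \<le> ?d y"
      proof (rule dist_trunc_ge)
        show "min \<bar>u x - u y\<bar> T - 2 * e \<le> T" using e by linarith
        fix a assume a: "a \<in> ?O"
        have "dist (u x) (u z) \<le> e" "dist (u a) (u z) \<le> e"
          using lipschitzD[OF u rho_ball_less[OF x e]] lipschitzD[OF u rho_ball_less[OF a e]] e(1)
          by (simp_all add: dist_real_def)
        moreover have "dist (u x) (u y) \<le> dist (u x) (u z) + (dist (u a) (u z) + dist (u y) (u a))"
          using dist_triangle2[of "u x" "u y" "u z"] dist_triangle2[of "u y" "u z" "u a"]
          by (simp add: dist_commute)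
        moreover have "min (dist (u x) (u y)) T \<le> dist (u x) (u y)" by simp
        ultimately have "min (dist (u x) (u y)) T - 2 * e \<le> dist (u y) (u a)" by simp
        then have "min \<bar>u x - u y\<bar> T - 2 * e \<le> \<bar>u y - u a\<bar>" by (simp add: dist_real_def)
        then have "ennreal (min \<bar>u x - u y\<bar> T - 2 * e) \<le> ennreal \<bar>u y - u a\<bar>" by (rule ennreal_leI)
        also have "\<dots> \<le> \<rho> y a" using u by (simp add: lipschitz_def)
        finally show "ennreal (min \<bar>u x - u y\<bar> T - 2 * e) \<le> \<rho> y a" .
      qed
      then have "(max 0 (min \<bar>u x - u y\<bar> T - 2 * e))\<^sup>2 \<le> (?d y)\<^sup>2"
        using dist_trunc_bounds(1)[of \<rho> ?O T y] by (intro power_mono) auto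
      then have "g p \<le> ennreal ((?d (fst p) - ?d (snd p))\<^sup>2)"
        using dx by (simp add: g_def x_def y_def ennreal_leI)
      then show ?thesis by (rule mult_right_mono) simp
    qed simp
    then have "emeasure N A \<le> mu_b m \<D> \<E> J ?d A"
      unfolding N[OF A(1)] mu_b_continuous[OF dist_continuous[OF T]] by (intro nn_integral_mono)
    also have "\<dots> \<le> emeasure m\<^sub>b A" by (rule dist_mu_b[OF T A(1)])
    finally show ?thesis .
  qed
  have "open S" if "S \<in> range (\<lambda>z. rho_ball z e)" for S using that open_rho_ball by auto
  then obtain F where F: "F \<subseteq> range (\<lambda>z. rho_ball z e)" "countable F"
      "\<Union>F = \<Union>(range (\<lambda>z. rho_ball z e))"
    by (rule Lindelof)
  have "z \<in> \<Union>F" for z unfolding F(3) using centre_rho_ball[OF e(1), of z] by (rule UN_I[OF UNIV_I])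
  then have "\<Union>F = UNIV" by blast
  moreover from this have Fne: "F \<noteq> {}" by blast
  ultimately have un: "(\<Union>i. from_nat_into F i) = UNIV" using range_from_nat_into[OF Fne F(2)] by simp
  have ball: "\<exists>z. from_nat_into F i = rho_ball z e" for i
    using subsetD[OF F(1) from_nat_into[OF Fne, of i]] by auto
  define D where "D = disjointed (from_nat_into F)"
  have "from_nat_into F i \<in> sets borel" for i using ball[of i] open_rho_ball by (auto intro: borel_open)
  then have "range D \<subseteq> sets borel"
    unfolding D_def by (intro sets.range_disjointed_sets) auto
  then have D: "\<And>i. D i \<in> sets borel" "disjoint_family D" "(\<Union>i. D i) = UNIV"
    using un unfolding D_def by (auto simp: disjoint_family_disjointed UN_disjointed_eq)
  have "emeasure N B = (\<Sum>i. emeasure N (B \<inter> D i))"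
    by (rule emeasure_disjoint_cover[OF _ D B]) (simp add: N_def)
  also have "\<dots> \<le> (\<Sum>i. emeasure m\<^sub>b (B \<inter> D i))"
  proof (intro suminf_le summableI)
    fix i
    obtain z where z: "from_nat_into F i = rho_ball z e" using ball by blast
    have "B \<inter> D i \<subseteq> rho_ball z e" using z disjointed_subset[of "from_nat_into F" i] by (auto simp: D_def)
    then show "emeasure N (B \<inter> D i) \<le> emeasure m\<^sub>b (B \<inter> D i)" by (intro small sets.Int B D(1))
  qed
  also have "\<dots> = emeasure m\<^sub>b B" by (rule emeasure_disjoint_cover[OF sets_mb D B, symmetric])
  finally show ?thesis unfolding N[OF B] g_def .
qed

text \<open>Let \<open>e\<close> tend to \<open>0\<close> and \<open>T\<close> to infinity in the preceding estimate, by Fatou's lemma.\<close>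

lemma lipschitz_mu_b:
  assumes u: "lipschitz u" and B: "B \<in> sets borel"
  shows "mu_b m \<D> \<E> J u B \<le> emeasure m\<^sub>b B"
proof -
  define g where "g n p = ennreal ((max 0 (min \<bar>u (fst p) - u (snd p)\<bar> (real (Suc n)) - 2 * inverse (real (Suc n))))\<^sup>2)
      * indicator B (fst p)" for n p
  have um: "u \<in> borel_measurable borel"
    by (rule borel_measurable_continuous_onI[OF lipschitz_continuous[OF u]])
  have mB: "(\<lambda>p. indicator B (fst p) :: ennreal) \<in> borel_measurable J"
    using B by (intro measurable_fst_J) simp
  have gm: "g n \<in> borel_measurable J" for n
    unfolding g_def using measurable_fst_J[OF um] measurable_snd_J[OF um] mB by measurable
  have lim: "(\<lambda>n. g n p) \<longlonglongrightarrow> ennreal ((u (fst p) - u (snd p))\<^sup>2) * indicator B (fst p)" for p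
  proof -
    let ?a = "\<bar>u (fst p) - u (snd p)\<bar>"
    obtain n0 :: nat where n0: "?a \<le> real n0" using real_arch_simple by blast
    have "eventually (\<lambda>n. ?a = min ?a (real (Suc n))) sequentially"
      using eventually_ge_at_top[of n0] by eventually_elim (use n0 in auto)
    then have "(\<lambda>n. min ?a (real (Suc n))) \<longlonglongrightarrow> ?a"
      by (rule Lim_transform_eventually[OF tendsto_const])
    then have "(\<lambda>n. (max 0 (min ?a (real (Suc n)) - 2 * inverse (real (Suc n))))\<^sup>2) \<longlonglongrightarrow> (max 0 (?a - 2 * 0))\<^sup>2"
      by (intro tendsto_intros LIMSEQ_inverse_real_of_nat)
    then have "(\<lambda>n. g n p) \<longlonglongrightarrow> ennreal ((max 0 (?a - 2 * 0))\<^sup>2) * indicator B (fst p)"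
      unfolding g_def by (cases "fst p \<in> B") (auto intro: tendsto_ennrealI)
    then show ?thesis by simp
  qed
  have "mu_b m \<D> \<E> J u B = (\<integral>\<^sup>+p. liminf (\<lambda>n. g n p) \<partial>J)"
    unfolding mu_b_continuous[OF lipschitz_continuous[OF u]]
    by (intro nn_integral_cong lim_imp_Liminf[OF _ lim, symmetric]) simp
  also have "\<dots> \<le> liminf (\<lambda>n. \<integral>\<^sup>+p. g n p \<partial>J)" by (rule nn_integral_liminf[OF gm])
  also have "\<dots> \<le> emeasure m\<^sub>b B"
  proof (rule order_trans[OF Liminf_le])
    show "eventually (\<lambda>n. (\<integral>\<^sup>+p. g n p \<partial>J) \<le> emeasure m\<^sub>b B) sequentially"
      unfolding g_def
      by (intro always_eventually allI truncated_jump_le[OF u _ _ _ B]) (auto simp: field_simps)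
  qed simp_all
  finally show ?thesis .
qed

end

section \<open>Staircase approximation\<close>

context intrinsic_metric_space
begin

context
  fixes U :: "'a \<Rightarrow> real" and M :: real and N :: nat
  assumes U: "lipschitz U" "\<And>x. 0 \<le> U x" "\<And>x. U x < M" and N: "N > 0"
begin

text \<open>The difference between the width \<open>step\<close> of a layer and the \<open>height\<close> at which a summand is cut off
is the gap on which the staircase is locally constant. Width and height are of order \<open>M / N\<close>, and
the \<open>N\<close> gaps together lose only one \<open>height\<close>.\<close>

definition step :: real where "step = M / real N"
definition height :: real where "height = M / (real N + 1)"
definition layer :: "nat \<Rightarrow> 'a \<Rightarrow> real" where
  "layer i = dist_trunc \<rho> {x. U x \<le> real i * step} height"
definition staircase :: "'a \<Rightarrow> real" where
  "staircase x = (\<Sum>i<N. layer i x)"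

lemma M_pos: "M > 0"
  using U(2,3) by (rule order_le_less_trans)

lemma heights: "0 < height" "height < step" "real N * step = M" "real N * (step - height) = height"
proof -
  show h: "0 < height" using M_pos by (simp add: height_def)
  show "height < step" using M_pos N by (simp add: height_def step_def divide_strict_left_mono)
  show st: "real N * step = M" using N by (simp add: step_def)
  have "(real N + 1) * height = M" by (simp add: height_def)
  then show "real N * (step - height) = height" using st by (simp add: algebra_simps)
qed

lemma layer_bounds: "0 \<le> layer i x" "layer i x \<le> height"
  using heights(1) by (simp_all add: layer_def dist_trunc_bounds)

lemma layer_low: "U x \<le> real i * step \<Longrightarrow> layer i x = 0"
  using dist_trunc_le[of x "{x. U x \<le> real i * step}" \<rho> x 0 height] layer_bounds(1)[of i x] rho_refl
  by (simp add: layer_def)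

text \<open>On \<open>A = {U \<le> i step}\<close> the value of \<open>U\<close> is lower by at least \<open>height\<close>, hence so far away is \<open>x\<close> from
\<open>A\<close>, \<open>U\<close> being 1-Lipschitz. For empty \<open>A\<close> the truncated distance is \<open>height\<close> by convention, in
agreement with this.\<close>

lemma layer_high:
  assumes x: "real i * step + height \<le> U x" shows "layer i x = height"
proof -
  have "height \<le> layer i x"
    unfolding layer_def
  proof (rule dist_trunc_ge)
    fix a assume "a \<in> {x. U x \<le> real i * step}"
    then have "height \<le> \<bar>U x - U a\<bar>" using x by simp
    then have "ennreal height \<le> ennreal \<bar>U x - U a\<bar>" by (rule ennreal_leI)
    also have "\<dots> \<le> \<rho> x a" using U(1) by (simp add: lipschitz_def)
    finally show "ennreal height \<le> \<rho> x a" .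
  qed simp
  then show ?thesis using layer_bounds(2)[of i x] by simp
qed

lemma layer_lipschitz:
  assumes "\<rho> x y \<le> ennreal r" "r \<ge> 0" shows "\<bar>layer i x - layer i y\<bar> \<le> r"
proof -
  have "layer i x \<le> layer i y + r" unfolding layer_def
    by (rule dist_trunc_shift[where \<rho> = \<rho> and x = x and y = y, OF _ assms]) (rule rho_triangle)
  moreover have "layer i y \<le> layer i x + r" unfolding layer_def
    by (rule dist_trunc_shift[where \<rho> = \<rho> and x = y and y = x, OF _ _ assms(2)], rule rho_triangle)
      (use assms(1) rho_sym[of x y] in simp)
  ultimately show ?thesis by simp
qed

lemma layer_multiples: "i < j \<Longrightarrow> real i * step + step \<le> real j * step"
  using mult_right_mono[of "real (Suc i)" "real j" step] heights by (simp add: algebra_simps)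

text \<open>The lower bound on \<open>U x\<close> reaches into the gap below the \<open>i\<close>-th layer, where the \<open>(i-1)\<close>-st summand is
already saturated. This makes the set of all such \<open>x\<close> open while it still contains the whole half-open
layer, boundary included.\<close>

lemma staircase_on_layer:
  assumes i: "i < N" and x: "real i * step - (step - height) < U x" "U x < (real i + 1) * step"
  shows "staircase x = layer i x + real i * height"
proof -
  have low: "layer j x = height" if "j < i" for j
    using layer_multiples[OF that] x(1) by (intro layer_high) argo
  have high: "layer j x = 0" if "i < j" for j
    using layer_multiples[OF that] x(2) by (intro layer_low) (simp add: algebra_simps)
  have "{..<N} = {..<i} \<union> {i..<N}" using i by auto
  then have "staircase x = (\<Sum>j\<in>{..<i} \<union> {i..<N}. layer j x)" by (simp add: staircase_def)
  also have "\<dots> = (\<Sum>j<i. layer j x) + (\<Sum>j\<in>{i..<N}. layer j x)"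
    by (rule sum.union_disjoint) auto
  also have "{i..<N} = insert i {i<..<N}" using i by auto
  finally have "staircase x = (\<Sum>j<i. layer j x) + (layer i x + (\<Sum>j\<in>{i<..<N}. layer j x))"
    by simp
  then show ?thesis using low high by simp
qed

lemma layer_index:
  obtains i where "i < N" "real i * step \<le> U x" "U x < (real i + 1) * step"
proof -
  have sp: "step > 0" using heights by linarith
  define i where "i = nat \<lfloor>U x / step\<rfloor>"
  have nn: "0 \<le> U x / step" using U(2)[of x] sp by simp
  have "real i \<le> U x / step" "U x / step < real i + 1" using nn unfolding i_def by linarith+
  then have i: "real i * step \<le> U x" "U x < (real i + 1) * step" using sp by (simp_all add: field_simps)
  have "real i * step < real N * step" using i(1) U(3)[of x] heights(3) by simp
  then have "i < N" using sp by simp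
  then show ?thesis using i that by blast
qed

lemma staircase_at:
  assumes i: "i < N" "real i * step \<le> U x" "U x < (real i + 1) * step"
  shows "staircase x = layer i x + real i * height"
  using staircase_on_layer[OF i(1) _ i(3)] i(2) heights(2) by simp

lemma staircase_nonneg: "0 \<le> staircase x"
  unfolding staircase_def by (intro sum_nonneg layer_bounds)

lemma staircase_le: "staircase x \<le> M"
proof -
  have "staircase x \<le> real N * height"
    unfolding staircase_def using sum_bounded_above[of "{..<N}" "\<lambda>i. layer i x" height] layer_bounds by simp
  also have "\<dots> \<le> real N * step" using heights by (intro mult_left_mono) auto
  finally show ?thesis using heights(3) by simp
qed

lemma staircase_near: "\<bar>staircase x - U x\<bar> \<le> 2 * M / real N"
proof -
  obtain i where i: "i < N" "real i * step \<le> U x" "U x < (real i + 1) * step" by (rule layer_index)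
  have "real i * (step - height) \<le> height"
    using mult_right_mono[of "real i" "real N" "step - height"] i(1) heights by simp
  moreover have "0 \<le> real i * (step - height)" using heights by simp
  ultimately have "\<bar>staircase x - U x\<bar> \<le> 2 * step"
    using staircase_at[OF i] i(2,3) layer_bounds[of i x] heights(1,2)
    by (simp add: abs_le_iff algebra_simps)
  then show ?thesis by (simp add: step_def)
qed

text \<open>For \<open>x\<close> and \<open>y\<close> in different layers the increment consists of three parts, each at most \<open>r\<close>: what
the summand of the layer of \<open>x\<close> still has to grow, what the summand of the layer of \<open>y\<close> has grown, and
the full layers in between, over which \<open>U\<close> itself increases.\<close>

lemma staircase_increment:
  assumes r: "\<rho> x y \<le> ennreal r" "r \<ge> 0"
    and i: "i < N" "real i * step \<le> U x" "U x < (real i + 1) * step"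
    and j: "j < N" "real j * step \<le> U y" "U y < (real j + 1) * step" and ij: "i \<le> j"
  shows "\<bar>staircase x - staircase y\<bar> \<le> 3 * r"
proof (cases "i = j")
  case True
  then show ?thesis
    using staircase_at[OF i] staircase_at[OF j] layer_lipschitz[OF r, of i] r(2) by simp
next
  case False
  then have lt: "i < j" using ij by simp
  have "layer i y = height"
    using layer_multiples[OF lt] j(2) heights(2) by (intro layer_high) linarith
  then have a: "height - layer i x \<le> r" using layer_lipschitz[OF r, of i] by simp
  have "layer j x = 0" using layer_multiples[OF lt] i(3) by (intro layer_low) (simp add: algebra_simps)
  then have b: "layer j y \<le> r" using layer_lipschitz[OF r, of j] by simp
  obtain d where d: "j = Suc (i + d)" using less_imp_Suc_add[OF lt] by auto
  have "real d * height \<le> real d * step" using heights(2) by (intro mult_left_mono) auto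
  also have "\<dots> \<le> U y - U x" using i(3) j(2) by (simp add: d algebra_simps)
  also have "\<dots> \<le> r" using lipschitzD[OF U(1) r] by simp
  finally have c: "real d * height \<le> r" .
  have "staircase y - staircase x = real d * height + (height - layer i x) + layer j y"
    using staircase_at[OF i] staircase_at[OF j] by (simp add: d algebra_simps)
  moreover have "0 \<le> real d * height" using heights(1) by simp
  ultimately have "staircase x \<le> staircase y" "staircase y - staircase x \<le> 3 * r"
    using a b c layer_bounds[of i x] layer_bounds[of j y] by linarith+
  then show ?thesis by simp
qed

lemma staircase_lipschitz: "lipschitz (\<lambda>x. staircase x / 3)"
proof (rule lipschitzI)
  fix x y r assume r: "\<rho> x y = ennreal r" "r \<ge> 0"
  obtain i where i: "i < N" "real i * step \<le> U x" "U x < (real i + 1) * step" by (rule layer_index)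
  obtain j where j: "j < N" "real j * step \<le> U y" "U y < (real j + 1) * step" by (rule layer_index)
  have "\<bar>staircase x - staircase y\<bar> \<le> 3 * r"
  proof (cases "i \<le> j")
    case True
    then show ?thesis using staircase_increment[OF _ r(2) i j] r(1) by simp
  next
    case False
    then show ?thesis using staircase_increment[OF _ r(2) j i] r(1) rho_sym[of x y] by (simp add: abs_minus_commute)
  qed
  then show "\<bar>staircase x / 3 - staircase y / 3\<bar> \<le> r" by (simp add: abs_le_iff field_simps)
qed

lemma staircase_continuous: "continuous_on UNIV staircase"
proof -
  have "continuous_on UNIV (\<lambda>x. 3 * (staircase x / 3))"
    by (intro continuous_intros lipschitz_continuous staircase_lipschitz)
  then show ?thesis by simp
qed

lemma staircase_locally_in_D: "locally_in_D staircase"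
proof -
  have "locally_in_D (\<lambda>x. \<Sum>i<N. layer i x)"
    by (intro locally_in_D_sum) (simp_all add: layer_def dist_locally_in_D heights(1))
  then show ?thesis unfolding staircase_def[abs_def] .
qed

lemma staircase_mu_b:
  assumes B: "B \<in> sets borel" shows "mu_b m \<D> \<E> J staircase B \<le> 9 * emeasure m\<^sub>b B"
proof -
  let ?v = "\<lambda>x. staircase x / 3"
  have sm: "?v \<in> borel_measurable borel"
    by (rule borel_measurable_continuous_onI[OF lipschitz_continuous[OF staircase_lipschitz]])
  have mB: "(\<lambda>p. indicator B (fst p) :: ennreal) \<in> borel_measurable J"
    using B by (intro measurable_fst_J) simp
  have "ennreal ((staircase a - staircase b)\<^sup>2) = 9 * ennreal ((?v a - ?v b)\<^sup>2)" for a b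
  proof -
    have "(staircase a - staircase b)\<^sup>2 = 9 * (?v a - ?v b)\<^sup>2" by (simp add: power2_eq_square field_simps)
    then show ?thesis by (simp add: ennreal_mult)
  qed
  then have "mu_b m \<D> \<E> J staircase B
      = (\<integral>\<^sup>+p. 9 * (ennreal ((?v (fst p) - ?v (snd p))\<^sup>2) * indicator B (fst p)) \<partial>J)"
    unfolding mu_b_continuous[OF staircase_continuous] by (simp add: mult.assoc)
  also have "\<dots> = 9 * mu_b m \<D> \<E> J ?v B"
    unfolding mu_b_continuous[OF lipschitz_continuous[OF staircase_lipschitz]]
    by (intro nn_integral_cmult borel_measurable_times_ennreal jump_measurable sm mB)
  also have "\<dots> \<le> 9 * emeasure m\<^sub>b B"
    by (intro mult_left_mono lipschitz_mu_b staircase_lipschitz B) simp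
  finally show ?thesis .
qed

text \<open>Partition \<open>X\<close> into the layers of \<open>U\<close>. Each layer has an open neighbourhood on which the staircase
equals one distance function up to a constant, so the two energy measures agree there.\<close>

lemma staircase_mu_c:
  assumes B: "B \<in> sets borel" shows "emeasure (mu_c m \<D> \<mu> staircase) B \<le> emeasure m\<^sub>c B"
proof -
  define L where "L i = {x. real i * step \<le> U x \<and> U x < (real i + 1) * step}" for i
  have Uc: "continuous_on UNIV U" by (rule lipschitz_continuous[OF U(1)])
  have Lb: "L i \<in> sets borel" for i
  proof -
    have "L i = {x. real i * step \<le> U x} \<inter> {x. U x < (real i + 1) * step}" by (auto simp: L_def)
    moreover have "closed {x. real i * step \<le> U x}" "open {x. U x < (real i + 1) * step}"
      by (intro closed_Collect_le open_Collect_less Uc continuous_on_const)+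
    ultimately show ?thesis by auto
  qed
  have disj: "disjoint_family L"
  proof -
    have "L i \<inter> L j = {}" if "i < j" for i j
      using layer_multiples[OF that] by (auto simp: L_def algebra_simps)
    then show ?thesis unfolding disjoint_family_on_def by (metis Int_commute linorder_neqE_nat)
  qed
  have un: "(\<Union>i. L i) = UNIV"
  proof -
    have "x \<in> (\<Union>i. L i)" for x by (rule layer_index[of x]) (auto simp: L_def)
    then show ?thesis by blast
  qed
  have piece: "emeasure (mu_c m \<D> \<mu> staircase) (B \<inter> L i) \<le> emeasure m\<^sub>c (B \<inter> L i)" for i
  proof (cases "i < N")
    case True
    define H where "H = {x. real i * step - (step - height) < U x \<and> U x < (real i + 1) * step}"
    have "H = {x. real i * step - (step - height) < U x} \<inter> {x. U x < (real i + 1) * step}"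
      by (auto simp: H_def)
    then have oH: "open H" by (auto intro!: open_Int open_Collect_less Uc continuous_on_const)
    have BL: "B \<inter> L i \<in> sets borel" using B Lb by auto
    have BH: "B \<inter> L i \<subseteq> H" using heights(2) by (auto simp: L_def H_def)
    have "emeasure (mu_c m \<D> \<mu> staircase) (B \<inter> L i) = emeasure (mu_c m \<D> \<mu> (layer i)) (B \<inter> L i)"
    proof (rule emeasure_mu_c_up_to_constant[OF staircase_locally_in_D _ oH _ BL BH])
      show "locally_in_D (layer i)" unfolding layer_def[abs_def] by (rule dist_locally_in_D[OF heights(1)])
      show "staircase x = layer i x + real i * height" if "x \<in> H" for x
        using that by (intro staircase_on_layer[OF True]) (simp_all add: H_def)
    qed
    also have "\<dots> \<le> emeasure m\<^sub>c (B \<inter> L i)"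
      unfolding layer_def[abs_def] by (rule dist_mu_c[OF heights(1) BL])
    finally show ?thesis .
  next
    case False
    have "L i = {}"
    proof -
      have "M \<le> real i * step" using False heights mult_right_mono[of "real N" "real i" step] by simp
      moreover have "U x < M" for x by (rule U(3))
      ultimately have "U x < real i * step" for x by (rule order_less_le_trans[rotated])
      then show ?thesis unfolding L_def by (simp add: not_le)
    qed
    then show ?thesis by simp
  qed
  have "emeasure (mu_c m \<D> \<mu> staircase) B = (\<Sum>i. emeasure (mu_c m \<D> \<mu> staircase) (B \<inter> L i))"
    by (rule emeasure_disjoint_cover[OF sets_mu_c[OF staircase_locally_in_D] Lb disj un B])
  also have "\<dots> \<le> (\<Sum>i. emeasure m\<^sub>c (B \<inter> L i))" by (intro suminf_le summableI piece)
  also have "\<dots> = emeasure m\<^sub>c B" by (rule emeasure_disjoint_cover[OF sets_mc Lb disj un B, symmetric])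
  finally show ?thesis .
qed

end

section \<open>Lipschitz functions\<close>

lemma emeasure_mc_finite:
  assumes "rel_compact G" "B \<subseteq> G" shows "emeasure m\<^sub>c B = ennreal (measure m\<^sub>c B)"
proof -
  have "compact (closure G)" using assms(1) by (simp add: rel_compact_def)
  then have "emeasure m\<^sub>c (closure G) < \<infinity>" using mc_radon by (auto simp: radon_on_def)
  moreover have "emeasure m\<^sub>c B \<le> emeasure m\<^sub>c (closure G)"
    using assms(2) closure_subset[of G] by (intro emeasure_mono) (auto simp: sets_mc)
  ultimately have "emeasure m\<^sub>c B \<noteq> \<infinity>" by (auto simp: top_unique)
  then show ?thesis by (simp add: emeasure_eq_ennreal_measure)
qed

text \<open>The minimum of \<open>U\<close> and \<open>\<psi>\<close> is the uniform limit of the truncated staircases. Their energies are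
bounded because a staircase has jump energy at most \<open>9 m\<^sub>b\<close> and diffusion energy at most \<open>m\<^sub>c\<close> on the
support of \<open>\<psi>\<close>. On \<open>G\<close> the truncation changes nothing, as staircases do not exceed \<open>M\<close>; so their energy
measures there are those of the untruncated staircases.\<close>

lemma truncated_lipschitz:
  assumes U: "lipschitz U" "\<And>x. 0 \<le> U x" "\<And>x. U x < M"
    and \<psi>: "\<psi> \<in> \<D>" "\<psi> \<in> Cc" "\<And>x. \<psi> x \<ge> 0" and G: "open G" "rel_compact G" "\<And>x. x \<in> G \<Longrightarrow> M \<le> \<psi> x"
  shows "(\<lambda>x. min (U x) (\<psi> x)) \<in> \<D>"
    and "\<And>B. B \<in> sets borel \<Longrightarrow> B \<subseteq> G \<Longrightarrow>
      \<mu> (\<lambda>x. min (U x) (\<psi> x)) (\<lambda>x. min (U x) (\<psi> x)) B \<le> measure m\<^sub>c B"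
proof -
  define K where "K = closure {x. \<psi> x \<noteq> 0}"
  have K: "compact K" using \<psi>(2) by (simp add: K_def Cc_def)
  have off: "\<psi> x = 0" if "x \<notin> K" for x
    using that subsetD[OF closure_subset, of x "{x. \<psi> x \<noteq> 0}"] by (auto simp: K_def)
  have \<psi>c: "continuous_on UNIV \<psi>" using \<psi>(2) by (simp add: Cc_def)
  have KB: "K \<in> sets borel" using compact_imp_closed[OF K] by auto
  define C where "C = ennreal (\<E> \<psi> \<psi>) + 9 * emeasure m\<^sub>b K
    + (6 * ennreal (\<mu> \<psi> \<psi> K) + 4 * emeasure m\<^sub>c K)"
  have "C < \<infinity>"
    using K mb_radon mc_radon unfolding C_def radon_on_def
    by (simp add: ennreal_mult_less_top ennreal_add_less_top)
  then obtain c where c: "C = ennreal c" "c \<ge> 0" by (cases C) auto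
  have cont: "continuous_on UNIV (\<lambda>x. min (U x) (\<psi> x))"
    by (intro continuous_intros lipschitz_continuous[OF U(1)] \<psi>c)
  have zero: "min (U x) (\<psi> x) = 0" if "x \<notin> K" for x using off[OF that] U(2)[of x] by simp
  have approx: "\<exists>h\<in>\<D>. continuous_on UNIV h \<and> (\<forall>x. x \<notin> K \<longrightarrow> h x = 0) \<and>
      (\<forall>x. \<bar>h x - min (U x) (\<psi> x)\<bar> \<le> e) \<and> E1 m \<E> h \<le> c + (\<integral>x. \<psi> x * \<psi> x \<partial>m) \<and>
      (\<forall>B\<in>sets borel. B \<subseteq> G \<longrightarrow> \<mu> h h B \<le> measure m\<^sub>c B)" if e: "e > 0" for e
  proof -
    have Mp: "M > 0" using U(2,3) by (rule order_le_less_trans)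
    obtain N :: nat where N': "2 * M / e < real N" using reals_Archimedean2 by blast
    have "0 < 2 * M / e" using e Mp by simp
    then have "0 < real N" using N' by (rule order_less_trans)
    then have N: "N > 0" "2 * M / real N \<le> e"
      using e N' by (simp_all add: field_simps)
    define w where "w = staircase U M N"
    note S = U N(1)
    have w: "locally_in_D w" "continuous_on UNIV w" "\<And>x. w x \<ge> 0"
      unfolding w_def by (rule staircase_locally_in_D[OF S] staircase_continuous[OF S] staircase_nonneg[OF S])+
    let ?h = "\<lambda>x. min (w x) (\<psi> x)"
    have hD: "?h \<in> \<D>" by (rule truncation_mem[OF w \<psi> K_def])
    have hc: "continuous_on UNIV ?h" by (intro continuous_intros w(2) \<psi>c)
    have h0: "?h x = 0" if "x \<notin> K" for x using off[OF that] w(3)[of x] by simp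
    have near: "\<bar>?h x - min (U x) (\<psi> x)\<bar> \<le> e" for x
    proof -
      have "\<bar>w x - U x\<bar> \<le> e" using staircase_near[OF S, of x] N(2) by (simp add: w_def)
      then show ?thesis by (auto simp: min_def)
    qed
    have "ennreal (\<E> ?h ?h) \<le> ennreal (\<E> \<psi> \<psi>) + mu_b m \<D> \<E> J w K
        + (6 * ennreal (\<mu> \<psi> \<psi> K) + 4 * emeasure (mu_c m \<D> \<mu> w) K)"
      by (rule energy_truncation_le[OF w \<psi> K_def])
    also have "\<dots> \<le> C"
      unfolding C_def w_def
      by (intro add_mono mult_left_mono order_refl staircase_mu_b[OF S KB] staircase_mu_c[OF S KB]) simp
    finally have "\<E> ?h ?h \<le> c" using c by (simp add: ennreal_le_iff)
    moreover have "(\<integral>x. ?h x * ?h x \<partial>m) \<le> (\<integral>x. \<psi> x * \<psi> x \<partial>m)"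
    proof (rule integral_mono[OF integrable_mult[OF hD hD] integrable_mult[OF \<psi>(1) \<psi>(1)]])
      fix x show "?h x * ?h x \<le> \<psi> x * \<psi> x"
        using w(3)[of x] \<psi>(3)[of x] by (intro mult_mono) auto
    qed
    ultimately have "E1 m \<E> ?h \<le> c + (\<integral>x. \<psi> x * \<psi> x \<partial>m)" unfolding E1_eq by (rule add_mono)
    moreover have "\<mu> ?h ?h B \<le> measure m\<^sub>c B" if B: "B \<in> sets borel" "B \<subseteq> G" for B
    proof -
      have "w x = ?h x" if "x \<in> G" for x
        using staircase_le[OF S, of x] G(3)[OF that] by (simp add: w_def)
      then have "ennreal (\<mu> ?h ?h B) = emeasure (mu_c m \<D> \<mu> w) B"
        by (intro emeasure_mu_c[OF w(1) G(1,2) hD _ B, symmetric] AE_I2) auto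
      also have "\<dots> \<le> ennreal (measure m\<^sub>c B)"
        using staircase_mu_c[OF S B(1)] emeasure_mc_finite[OF G(2) B(2)] by (simp add: w_def)
      finally show ?thesis by (simp add: ennreal_le_iff)
    qed
    ultimately show ?thesis using hD hc h0 near by blast
  qed
  show "(\<lambda>x. min (U x) (\<psi> x)) \<in> \<D>"
    by (rule energy_closure(1)[OF G(1,2) K cont zero approx])
  show "\<mu> (\<lambda>x. min (U x) (\<psi> x)) (\<lambda>x. min (U x) (\<psi> x)) B \<le> measure m\<^sub>c B"
    if B: "B \<in> sets borel" "B \<subseteq> G" for B
    by (rule energy_closure(2)[OF G(1,2) K cont zero approx B])
qed

text \<open>On the compact closure of \<open>G\<close> the function \<open>u\<close> is bounded by some \<open>b\<close>, so \<open>u + b\<close> agrees on \<open>G\<close> with its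
clamping \<open>U\<close> to \<open>[0, 2 b]\<close>, which is again 1-Lipschitz. Subtract from the minimum of \<open>U\<close> and \<open>\<psi>\<close> a function
of \<open>\<D>\<close> that equals \<open>b\<close> on \<open>G\<close>; constants do not affect the energy measure.\<close>

lemma lipschitz_representative:
  assumes u: "lipschitz u" and G: "open G" "rel_compact G"
  obtains v where "v \<in> \<D>" "\<And>x. x \<in> G \<Longrightarrow> u x = v x"
    "\<And>B. B \<in> sets borel \<Longrightarrow> B \<subseteq> G \<Longrightarrow> \<mu> v v B \<le> measure m\<^sub>c B"
proof -
  have cG: "compact (closure G)" using G(2) by (simp add: rel_compact_def)
  have "bounded (u ` closure G)"
    by (intro compact_imp_bounded compact_continuous_image cG continuous_on_subset[OF lipschitz_continuous[OF u]]) simp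
  then obtain b where b: "b > 0" "\<And>x. x \<in> closure G \<Longrightarrow> \<bar>u x\<bar> \<le> b"
    unfolding bounded_pos by (auto simp: real_norm_def)
  define F where "F s = max 0 (min (s + b) (2 * b))" for s :: real
  define U where "U x = F (u x)" for x
  have U: "lipschitz U" "\<And>x. 0 \<le> U x" "\<And>x. U x < 2 * b + 1"
    unfolding U_def using b(1)
    by (auto simp: F_def intro!: lipschitz_contraction[OF u])
  have UG: "U x = u x + b" if "x \<in> G" for x
    using b(2)[OF subsetD[OF closure_subset that]] by (auto simp: U_def F_def)
  obtain \<phi> where \<phi>: "\<phi> \<in> \<D>" "\<phi> \<in> Cc" "\<And>x. 0 \<le> \<phi> x" "\<And>x. x \<in> closure G \<Longrightarrow> \<phi> x = 1"
    by (rule cutoff[OF loc_compact cG]) blast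
  have \<phi>G: "\<phi> x = 1" if "x \<in> G" for x by (rule \<phi>(4)[OF subsetD[OF closure_subset that]])
  define \<psi> where "\<psi> x = (2 * b + 1) * \<phi> x" for x
  have \<psi>: "\<psi> \<in> \<D>" "\<psi> \<in> Cc" "\<And>x. \<psi> x \<ge> 0" "\<And>x. x \<in> G \<Longrightarrow> 2 * b + 1 \<le> \<psi> x"
  proof -
    show "\<psi> \<in> \<D>" unfolding \<psi>_def[abs_def] by (rule scale_mem[OF \<phi>(1)])
    have "{x. \<psi> x \<noteq> 0} = {x. \<phi> x \<noteq> 0}" using b(1) by (auto simp: \<psi>_def)
    moreover have "continuous_on UNIV \<psi>"
      unfolding \<psi>_def[abs_def] using \<phi>(2) by (auto simp: Cc_def intro!: continuous_intros)
    ultimately show "\<psi> \<in> Cc" using \<phi>(2) by (simp add: Cc_def)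
    show "\<psi> x \<ge> 0" for x using \<phi>(3) b(1) by (simp add: \<psi>_def)
    show "2 * b + 1 \<le> \<psi> x" if "x \<in> G" for x using \<phi>G[OF that] by (simp add: \<psi>_def)
  qed
  let ?w = "\<lambda>x. min (U x) (\<psi> x)"
  have w: "?w \<in> \<D>" by (rule truncated_lipschitz(1)[OF U \<psi>(1-3) G \<psi>(4)])
  have wG: "?w x = u x + b" if "x \<in> G" for x using UG[OF that] \<psi>(4)[OF that] U(3)[of x] by simp
  let ?v = "\<lambda>x. ?w x - b * \<phi> x"
  have v: "?v \<in> \<D>" by (intro diff_mem scale_mem w \<phi>(1))
  show ?thesis
  proof (rule that[OF v])
    show "u x = ?v x" if "x \<in> G" for x using wG[OF that] \<phi>G[OF that] by simp
    show "\<mu> ?v ?v B \<le> measure m\<^sub>c B" if B: "B \<in> sets borel" "B \<subseteq> G" for B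
    proof -
      have "\<mu> ?v ?v B = \<mu> ?w ?w B"
        by (rule mu_local_up_to_constant[OF v w G _ B, where c = "- b"])
          (intro AE_I2 impI, simp add: \<phi>G)
      also have "\<dots> \<le> measure m\<^sub>c B"
        by (rule truncated_lipschitz(2)[OF U \<psi>(1-3) G \<psi>(4) B])
      finally show ?thesis .
    qed
  qed
qed

lemma lipschitz_locally_in_D: assumes u: "lipschitz u" shows "locally_in_D u"
  unfolding locally_in_D_def
proof (intro allI impI)
  fix G :: "'a set" assume G: "open G" "rel_compact G"
  obtain v where v: "v \<in> \<D>" "\<And>x. x \<in> G \<Longrightarrow> u x = v x"
    by (rule lipschitz_representative[OF u G]) blast
  show "\<exists>v\<in>\<D>. AE x in m. x \<in> G \<longrightarrow> u x = v x"
    by (rule bexI[OF _ v(1)], intro AE_I2 impI, rule v(2))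
qed

lemma lipschitz_mu_c:
  assumes u: "lipschitz u" and B: "B \<in> sets borel"
  shows "emeasure (mu_c m \<D> \<mu> u) B \<le> emeasure m\<^sub>c B"
proof -
  obtain G D :: "nat \<Rightarrow> 'a set" where G: "\<And>n. open (G n)" "\<And>n. rel_compact (G n)"
    and D: "\<And>n. D n \<subseteq> G n" "\<And>n. D n \<in> sets borel" "disjoint_family D" "(\<Union>n. D n) = UNIV"
    by (rule disjoint_rel_compact_cover) blast
  note lu = lipschitz_locally_in_D[OF u]
  have piece: "emeasure (mu_c m \<D> \<mu> u) (B \<inter> D i) \<le> emeasure m\<^sub>c (B \<inter> D i)" for i
  proof -
    have BD: "B \<inter> D i \<in> sets borel" "B \<inter> D i \<subseteq> G i" using B D(1,2)[of i] by auto
    obtain v where v: "v \<in> \<D>" "\<And>x. x \<in> G i \<Longrightarrow> u x = v x"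
      "\<And>B. B \<in> sets borel \<Longrightarrow> B \<subseteq> G i \<Longrightarrow> \<mu> v v B \<le> measure m\<^sub>c B"
      by (rule lipschitz_representative[OF u G(1) G(2), of i]) blast
    have "emeasure (mu_c m \<D> \<mu> u) (B \<inter> D i) = ennreal (\<mu> v v (B \<inter> D i))"
      by (rule emeasure_mu_c[OF lu G(1) G(2) v(1) _ BD]) (use v(2) in \<open>auto intro: AE_I2\<close>)
    also have "\<dots> \<le> ennreal (measure m\<^sub>c (B \<inter> D i))" by (intro ennreal_leI v(3) BD)
    also have "\<dots> = emeasure m\<^sub>c (B \<inter> D i)" by (rule emeasure_mc_finite[OF G(2) BD(2), symmetric])
    finally show ?thesis .
  qed
  have "emeasure (mu_c m \<D> \<mu> u) B = (\<Sum>i. emeasure (mu_c m \<D> \<mu> u) (B \<inter> D i))"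
    by (rule emeasure_disjoint_cover[OF sets_mu_c[OF lu] D(2-4) B])
  also have "\<dots> \<le> (\<Sum>i. emeasure m\<^sub>c (B \<inter> D i))" by (intro suminf_le summableI piece)
  also have "\<dots> = emeasure m\<^sub>c B" by (rule emeasure_disjoint_cover[OF sets_mc D(2-4) B, symmetric])
  finally show ?thesis .
qed

lemma lipschitz_D_loc_star:
  assumes u: "lipschitz u" shows "u \<in> D_loc_star m \<D> \<E> J"
proof -
  have uc: "continuous_on UNIV u" by (rule lipschitz_continuous[OF u])
  have um: "u \<in> borel_measurable m" unfolding measurable_m by (rule borel_measurable_continuous_onI[OF uc])
  have "set_integrable m K (\<lambda>x. (u x)\<^sup>2)" if K: "compact K" for K
  proof -
    have "bounded (u ` K)"
      by (intro compact_imp_bounded compact_continuous_image K continuous_on_subset[OF uc]) simp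
    then obtain b where b: "\<And>x. x \<in> K \<Longrightarrow> \<bar>u x\<bar> \<le> b" unfolding bounded_iff by auto
    have Km: "K \<in> sets m" using borel_closed[OF compact_imp_closed[OF K]] sets_m by simp
    have fin: "emeasure m K < \<infinity>" using m_radon K by (auto simp: radon_on_def)
    show ?thesis
      unfolding set_integrable_def
    proof (rule integrableI_bounded_set[where A = K and B = "b\<^sup>2"])
      show "AE x in m. x \<in> K \<longrightarrow> norm (indicator K x *\<^sub>R (u x)\<^sup>2) \<le> b\<^sup>2"
      proof (intro AE_I2 impI)
        fix x assume x: "x \<in> K"
        have "\<bar>u x\<bar>\<^sup>2 \<le> b\<^sup>2" by (rule power_mono[OF b[OF x]]) simp
        then show "norm (indicator K x *\<^sub>R (u x)\<^sup>2) \<le> b\<^sup>2" using x by simp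
      qed
    qed (use Km fin um in auto)
  qed
  then have "u \<in> D_loc m \<D>"
    using um lipschitz_locally_in_D[OF u] by (simp add: D_loc_iff L2_loc_def)
  moreover have "mu_b m \<D> \<E> J u K < \<infinity>" if K: "compact K" for K
  proof -
    have "K \<in> sets borel" using compact_imp_closed[OF K] by auto
    then have "mu_b m \<D> \<E> J u K \<le> emeasure m\<^sub>b K" by (rule lipschitz_mu_b[OF u])
    also have "\<dots> < \<infinity>" using mb_radon K by (auto simp: radon_on_def)
    finally show ?thesis .
  qed
  ultimately show ?thesis by (simp add: D_loc_star_def)
qed

end

theorem theorem4p8:
  fixes m :: "'a::{metric_space,second_countable_topology} measure"
    and \<D> :: "('a \<Rightarrow> real) set"
    and \<E> :: "('a \<Rightarrow> real) \<Rightarrow> ('a \<Rightarrow> real) \<Rightarrow> real"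
    and J :: "('a \<times> 'a) measure"
    and \<mu> :: "('a \<Rightarrow> real) \<Rightarrow> ('a \<Rightarrow> real) \<Rightarrow> 'a set \<Rightarrow> real"
    and k :: "'a measure"
    and \<rho> :: "'a \<Rightarrow> 'a \<Rightarrow> ennreal"
    and u :: "'a \<Rightarrow> real"
  assumes "locally compact (UNIV :: 'a set)"
    and "radon_measure m"
    and "measure_support m = UNIV"
    and "regular_dirichlet_form m \<D> \<E>"
    and "beurling_deny m \<D> \<E> J \<mu> k"
    and "intrinsic_metric m \<D> \<E> J \<mu> \<rho>"
    and "\<And>x y. ennreal \<bar>u x - u y\<bar> \<le> \<rho> x y"
  shows "u \<in> D_loc_star m \<D> \<E> J \<and> (\<forall>B\<in>sets borel. mu_d m \<D> \<E> J \<mu> u B \<le> emeasure m B)"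
proof -
  obtain m\<^sub>b m\<^sub>c where rad: "radon_measure m\<^sub>b" "radon_measure m\<^sub>c"
    and sum_le: "\<And>B. B \<in> sets borel \<Longrightarrow> emeasure m\<^sub>b B + emeasure m\<^sub>c B \<le> emeasure m B"
    and dist: "\<And>A T. T > 0 \<Longrightarrow> dist_trunc \<rho> A T \<in> D_loc_star m \<D> \<E> J \<and>
           continuous_on UNIV (dist_trunc \<rho> A T) \<and>
           (\<forall>B\<in>sets borel. mu_b m \<D> \<E> J (dist_trunc \<rho> A T) B \<le> emeasure m\<^sub>b B) \<and>
           (\<forall>B\<in>sets borel. emeasure (mu_c m \<D> \<mu> (dist_trunc \<rho> A T)) B \<le> emeasure m\<^sub>c B)"
    using assms(6) unfolding intrinsic_metric_def by blast
  have pm: "pseudo_metric \<rho>" using assms(6) by (simp add: intrinsic_metric_def)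
  interpret lc_beurling_deny m \<D> \<E> J \<mu> k
    by (rule lc_beurling_deny.intro[OF assms(5) lc_beurling_deny_axioms.intro[OF assms(1,2)]])
  interpret intrinsic_metric_space m \<D> \<E> J \<mu> k \<rho> m\<^sub>b m\<^sub>c
  proof (unfold_locales, rule pm, rule rad(1), rule rad(2))
    fix A :: "'a set" and T :: real assume T: "T > 0"
    show "locally_in_D (dist_trunc \<rho> A T)"
      using dist[OF T, of A] by (simp add: D_loc_star_def D_loc_iff)
    show "continuous_on UNIV (dist_trunc \<rho> A T)" using dist[OF T] by blast
    fix B :: "'a set" assume B: "B \<in> sets borel"
    show "mu_b m \<D> \<E> J (dist_trunc \<rho> A T) B \<le> emeasure m\<^sub>b B" using dist[OF T] B by blast
    show "emeasure (mu_c m \<D> \<mu> (dist_trunc \<rho> A T)) B \<le> emeasure m\<^sub>c B" using dist[OF T] B by blast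
  qed
  have u: "lipschitz u" using assms(7) by (simp add: lipschitz_def)
  show ?thesis
  proof (intro conjI ballI)
    show "u \<in> D_loc_star m \<D> \<E> J" by (rule lipschitz_D_loc_star[OF u])
    fix B :: "'a set" assume B: "B \<in> sets borel"
    have "mu_d m \<D> \<E> J \<mu> u B \<le> emeasure m\<^sub>b B + emeasure m\<^sub>c B"
      unfolding mu_d_def by (intro add_mono lipschitz_mu_b[OF u B] lipschitz_mu_c[OF u B])
    also have "\<dots> \<le> emeasure m B" by (rule sum_le[OF B])
    finally show "mu_d m \<D> \<E> J \<mu> u B \<le> emeasure m B" .
  qed
qed

end
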